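(* Let the data $H,\nu,(\alpha_k),(\lambda_k),(\beta_k^H)$ and $\tau>0$ be as in the context. Assume that there are $m\in\mathbb{N}$, $m\ge 2$, and $\gamma\in(0,1)$ such that $$\sum_{k\in K}\lambda_k\alpha_k^{2\gamma-2H}|k|^{2m}<\infty\quad\text{and}\quad \sum_{k\in K}\lambda_k\alpha_k^{-2H}|k|^{2m+2\gamma}<\infty .$$ Let $\psi$ be the (real-valued) version, with sample paths $\mathbb{P}$-a.s. in $C(\mathbb{R},C^m(\mathbb{T}^2))$, of the ergodic mild solution of $d\psi_t=\nu A\psi_t\,dt+\nu^HQ^{1/2}dB^H_t$. Then the transport equation $$\tau\ddot x(t)=v(x(t),t)-\dot x(t),\qquad v=\nabla^\bot\psi,\qquad (x(0),\dot x(0))\in\mathbb{T}^2\times\mathbb{R}^2,$$ has $\mathbb{P}$-a.s. a unique global $C^{m-1}$-solution.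
   Context: $\mathbb{T}^2=\mathbb{R}^2/\mathbb{Z}^2$ is the two-dimensional torus. $K:=2\pi\mathbb{Z}^2\setminus\{(0,0)\}$, $e_k(x)=e^{i\langle k,x\rangle}$, and $V$ is the Hilbert space of (complex-valued) periodic $f\in L^2(\mathbb{T}^2)$ with $\int_{\mathbb{T}^2}f\,dx=0$, with orthonormal basis $(e_k)_{k\in K}$. Standing assumptions: $\tau,\nu>0$, $H\in(0,1)$. $A:\mathcal{D}(A)\subset V\to V$ is linear with $Ae_k=-\alpha_ke_k$, where $\alpha_k\in[c,\infty)$ for some $c>0$, $\alpha_k=\alpha_{-k}$, $\alpha_k\to\infty$ as $|k|\to\infty$, and $\mathcal{D}(A)=\{f\in V:\sum_k\alpha_k^2|\langle f,e_k\rangle_V|^2<\infty\}$. $Q^{1/2}$ is a bounded linear operator on $V$ with $Q^{1/2}e_k=\sqrt{\lambda_k}e_k$, $\sqrt{\lambda_k}=\sqrt{\lambda_{-k}}\ge0$. On a probability space $(\Omega,\mathcal{F},\mathbb{P})$, $B^H(t)=\sum_{k\in K}\beta^H_k(t)e_k$, $t\in\mathbb{R}$ (formal series), where $\beta_k^H=\frac1{\sqrt2}b_k+\frac{i}{\sqrt2}b_k'$ with $b_k,b_k'$ independent real normalized two-sided fractional Brownian motions of Hurst parameter $H$ (centered continuous Gaussian processes with covariance $\frac12(|t|^{2H}+|s|^{2H}-|t-s|^{2H})$), and different $\beta^H_k$ are independent except that $\beta^H_{-k}=(\beta_k^H)^*$ (complex conjugate). Under the summability assumptions, the equation $d\psi_t=\nu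 A\psi_t\,dt+\nu^HQ^{1/2}dB^H_t$ has a unique ergodic mild solution, given by $\psi(t)=\sum_{k\in K}\sqrt{\lambda_k}\,\nu^H\int_{-\infty}^te^{-(t-u)\nu\alpha_k}d\beta^H_k(u)\,e_k$, $t\in\mathbb{R}$, and it has a version with paths $\mathbb{P}$-a.s. in $C(\mathbb{R},C^m(\mathbb{T}^2))$; this version is used. $\nabla^\bot\psi=(\partial\psi/\partial x_2,-\partial\psi/\partial x_1)$. The transport equation is understood as the first-order system $\frac{d}{dt}(x(t),\dot x(t))=f_{\psi(\omega),\tau}(t,(x(t),\dot x(t)))$, $(x(0),\dot x(0))=(\overline x,\overline y)\in\mathbb{T}^2\times\mathbb{R}^2$, with $f_{\psi(\omega),\tau}(t,x,y)=\big(y,\frac1\tau(\nabla^\bot\psi(x,t)(\omega)-y)\big)$. The equation has a unique global $C^{n}$-solution $\mathbb{P}$-a.s. ($n\in\mathbb{N}$) if $\mathbb{P}$-a.s. for all $(\overline x,\overline y)\in\mathbb{T}^2\times\mathbb{R}^2$ there is exactly one solution of the system on all of $\mathbb{R}$ with this initial value, and the solution, as a function of $t$ and of the initial value, belongs to $C^1\big(\mathbb{R},C^{n}(\mathbb{T}^2\times\mathbb{R}^2,\mathbb{T}^2\times\mathbb{R}^2)\big)$ (where $C^n$ carries the topology of uniform convergence of derivatives up to order $n$ on compact sets). *)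

theory Defs
  imports "HOL-Probability.Probability"
begin

definition same_torus_point :: "real^2 \<Rightarrow> real^2 \<Rightarrow> bool" where
  "same_torus_point x y \<longleftrightarrow> (\<forall>i. x $ i - y $ i \<in> \<int>)"

lemma equivp_same_torus_point: "equivp same_torus_point"
proof (rule equivpI)
  show "reflp same_torus_point"
    by (auto simp: reflp_def same_torus_point_def)
  show "symp same_torus_point"
    unfolding symp_def same_torus_point_def by (metis Ints_minus minus_diff_eq)
  show "transp same_torus_point"
  proof (rule transpI, unfold same_torus_point_def, intro allI)
    fix x y z :: "real^2" and i
    assume "\<forall>i. x $ i - y $ i \<in> \<int>" "\<forall>i. y $ i - z $ i \<in> \<int>"
    then have "(x $ i - y $ i) + (y $ i - z $ i) \<in> \<int>"
      by (blast intro: Ints_add)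
    then show "x $ i - z $ i \<in> \<int>"
      by simp
  qed
qed

quotient_type torus = "real^2" / same_torus_point
  morphisms torus_rep torus_proj
  by (rule equivp_same_torus_point)

text \<open>\<open>torus_proj\<close> is the quotient map; \<open>torus_rep\<close> picks some representative and is only
  used below in expressions that do not depend on the choice. The tangent bundle of the torus is
  the product of the torus with the plane, and \<open>phase_proj\<close> is its universal covering.\<close>

type_synonym plane = "real^2"
type_synonym phase = "torus \<times> plane"

definition phase_proj :: "plane \<times> plane \<Rightarrow> phase" where
  "phase_proj z = (torus_proj (fst z), snd z)"

fun iter_deriv :: "'a::euclidean_space list \<Rightarrow> ('a \<Rightarrow> 'b::real_normed_vector) \<Rightarrow> 'a \<Rightarrow> 'b" where
  "iter_deriv [] f = f"
| "iter_deriv (v # vs) f = (\<lambda>x. frechet_derivative (iter_deriv vs f) (at x) v)"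

definition C_k :: "nat \<Rightarrow> ('a::euclidean_space \<Rightarrow> 'b::real_normed_vector) \<Rightarrow> bool" where
  "C_k n f \<longleftrightarrow> (\<forall>vs. set vs \<subseteq> Basis \<longrightarrow>
     (length vs < n \<longrightarrow> (\<forall>x. iter_deriv vs f differentiable (at x))) \<and>
     (length vs \<le> n \<longrightarrow> continuous_on UNIV (iter_deriv vs f)))"

text \<open>Convergence in the topology of uniform convergence of the derivatives up to order \<open>n\<close> on
  compact sets. For (lifts of) functions on the torus this is convergence in the usual
  \<open>C^n\<close> norm, by periodicity.\<close>

definition C_k_tendsto ::
  "nat \<Rightarrow> ('t \<Rightarrow> 'a::euclidean_space \<Rightarrow> 'b::real_normed_vector) \<Rightarrow> ('a \<Rightarrow> 'b) \<Rightarrow> 't filter \<Rightarrow> bool"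
where
  "C_k_tendsto n u f F \<longleftrightarrow> (\<forall>vs S. set vs \<subseteq> Basis \<and> length vs \<le> n \<and> compact S \<longrightarrow>
     uniform_limit S (\<lambda>t. iter_deriv vs (u t)) (iter_deriv vs f) F)"

definition C0_C_k :: "nat \<Rightarrow> (real \<Rightarrow> 'a::euclidean_space \<Rightarrow> 'b::real_normed_vector) \<Rightarrow> bool" where
  "C0_C_k n u \<longleftrightarrow> (\<forall>t. C_k n (u t)) \<and> (\<forall>t. C_k_tendsto n u (u t) (at t))"

definition C1_C_k :: "nat \<Rightarrow> (real \<Rightarrow> 'a::euclidean_space \<Rightarrow> 'b::real_normed_vector) \<Rightarrow> bool" where
  "C1_C_k n u \<longleftrightarrow> (\<forall>t. C_k n (u t)) \<and> (\<exists>u'. C0_C_k n u' \<and>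
     (\<forall>t. C_k_tendsto n (\<lambda>h x. (u (t + h) x - u t x) /\<^sub>R h) (u' t) (at 0)))"

definition C0_C_k_torus :: "nat \<Rightarrow> (real \<Rightarrow> torus \<Rightarrow> real) \<Rightarrow> bool" where
  "C0_C_k_torus n u \<longleftrightarrow> C0_C_k n (\<lambda>t x. u t (torus_proj x))"

text \<open>The space \<open>C^1(\<real>, C^n(phase, phase))\<close>. As the phase space is a quotient of
  \<open>plane \<times> plane\<close> by translations, the smoothness of a phase-valued map is that of its lift to
  the (simply connected) universal coverings.\<close>

definition C1_C_k_phase :: "nat \<Rightarrow> (real \<Rightarrow> phase \<Rightarrow> phase) \<Rightarrow> bool" where
  "C1_C_k_phase n \<Phi> \<longleftrightarrow> (\<exists>U :: real \<Rightarrow> plane \<times> plane \<Rightarrow> plane \<times> plane.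
     (\<forall>t z. phase_proj (U t z) = \<Phi> t (phase_proj z)) \<and> C1_C_k n U)"

text \<open>Differentiability of a phase-valued curve at \<open>t\<close> is expressed through a lift near \<open>t\<close>.\<close>

definition has_phase_derivative :: "(real \<Rightarrow> phase) \<Rightarrow> plane \<times> plane \<Rightarrow> real \<Rightarrow> bool" where
  "has_phase_derivative Z d t \<longleftrightarrow> (\<exists>\<zeta>.
     (\<forall>\<^sub>F s in nhds t. phase_proj (\<zeta> s) = Z s) \<and> (\<zeta> has_vector_derivative d) (at t))"

definition global_solution ::
  "(real \<Rightarrow> phase \<Rightarrow> plane \<times> plane) \<Rightarrow> phase \<Rightarrow> (real \<Rightarrow> phase) \<Rightarrow> bool" where
  "global_solution f z Z \<longleftrightarrow> Z 0 = z \<and> (\<forall>t. has_phase_derivative Z (f t (Z t)) t)"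

definition unique_global_C_k_solution ::
  "nat \<Rightarrow> (real \<Rightarrow> phase \<Rightarrow> plane \<times> plane) \<Rightarrow> bool" where
  "unique_global_C_k_solution n f \<longleftrightarrow>
     (\<forall>z. \<exists>!Z. global_solution f z Z) \<and>
     C1_C_k_phase n (\<lambda>t z. (THE Z. global_solution f z Z) t)"

definition torus_partial :: "2 \<Rightarrow> (torus \<Rightarrow> real) \<Rightarrow> torus \<Rightarrow> real" where
  "torus_partial i f p = frechet_derivative (\<lambda>x. f (torus_proj x)) (at (torus_rep p)) (axis i 1)"

definition grad_perp :: "(torus \<Rightarrow> real) \<Rightarrow> torus \<Rightarrow> real^2" where
  "grad_perp f p = vector [torus_partial 2 f p, - torus_partial 1 f p]"

definition transport_field ::
  "real \<Rightarrow> (real \<Rightarrow> torus \<Rightarrow> real) \<Rightarrow> real \<Rightarrow> phase \<Rightarrow> plane \<times> plane" where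
  "transport_field \<tau> \<psi> t z =
     (snd z, (1 / \<tau>) *\<^sub>R (grad_perp (\<psi> t) (fst z) - snd z))"

definition freqs :: "(real^2) set" where
  "freqs = {k. \<forall>i. \<exists>j::int. k $ i = 2 * pi * of_int j} - {0}"

definition fourier_basis :: "real^2 \<Rightarrow> torus \<Rightarrow> complex" where
  "fourier_basis k p = exp (\<i> * of_real (k \<bullet> torus_rep p))"

text \<open>Integrals over the torus are integrals over the fundamental domain \<open>cbox 0 1\<close>.\<close>

definition in_V :: "(torus \<Rightarrow> complex) \<Rightarrow> bool" where
  "in_V f \<longleftrightarrow>
     (\<lambda>x. f (torus_proj x)) \<in> borel_measurable lebesgue \<and>
     set_integrable lebesgue (cbox 0 1) (\<lambda>x. (cmod (f (torus_proj x)))\<^sup>2) \<and>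
     (LINT x:cbox 0 1|lebesgue. f (torus_proj x)) = 0"

text \<open>\<open>f\<close> is the sum of \<open>a k\<close> times \<open>fourier_basis k\<close> over all frequencies \<open>k\<close>, with
  (unconditional) convergence in the norm of V.\<close>

definition has_fourier_sum :: "(torus \<Rightarrow> complex) \<Rightarrow> (real^2 \<Rightarrow> complex) \<Rightarrow> bool" where
  "has_fourier_sum f a \<longleftrightarrow> in_V f \<and>
     ((\<lambda>F. LINT x:cbox 0 1|lebesgue.
         (cmod (f (torus_proj x) - (\<Sum>k\<in>F. a k * fourier_basis k (torus_proj x))))\<^sup>2)
       \<longlongrightarrow> 0) (finite_subsets_at_top freqs)"

definition gaussian_rv :: "'w measure \<Rightarrow> ('w \<Rightarrow> real) \<Rightarrow> bool" where
  "gaussian_rv M X \<longleftrightarrow> X \<in> borel_measurable M \<and>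
     (\<exists>\<mu> \<sigma>. (\<sigma> = 0 \<and> (AE \<omega> in M. X \<omega> = \<mu>)) \<or>
       (\<sigma> > 0 \<and> distributed M lborel X (\<lambda>x. ennreal (normal_density \<mu> \<sigma> x))))"

definition gaussian_process :: "'w measure \<Rightarrow> (real \<Rightarrow> 'w \<Rightarrow> real) \<Rightarrow> bool" where
  "gaussian_process M X \<longleftrightarrow>
     (\<forall>S c. finite S \<longrightarrow> gaussian_rv M (\<lambda>\<omega>. \<Sum>t\<in>S. c t * X t \<omega>))"

definition two_sided_fbm :: "'w measure \<Rightarrow> real \<Rightarrow> (real \<Rightarrow> 'w \<Rightarrow> real) \<Rightarrow> bool" where
  "two_sided_fbm M H b \<longleftrightarrow>
     gaussian_process M b \<and>
     (\<forall>t. prob_space.expectation M (b t) = 0) \<and>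
     (\<forall>s t. prob_space.expectation M (\<lambda>\<omega>. b t \<omega> * b s \<omega>) =
        (\<bar>t\<bar> powr (2 * H) + \<bar>s\<bar> powr (2 * H) - \<bar>t - s\<bar> powr (2 * H)) / 2) \<and>
     (AE \<omega> in M. continuous_on UNIV (\<lambda>t. b t \<omega>))"

text \<open>The processes \<open>b k\<close> and \<open>b' k\<close>, viewed as random elements of \<open>real \<Rightarrow> real\<close>, are jointly
  independent as \<open>k\<close> ranges over any set of frequencies that contains no two opposite ones.\<close>

definition fractional_noise :: "'w measure \<Rightarrow> real \<Rightarrow> (real^2 \<Rightarrow> real \<Rightarrow> 'w \<Rightarrow> complex) \<Rightarrow> bool" where
  "fractional_noise M H \<beta> \<longleftrightarrow>
     (\<forall>k\<in>freqs. \<forall>t. \<forall>\<omega>\<in>space M. \<beta> (- k) t \<omega> = cnj (\<beta> k t \<omega>)) \<and>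
     (\<exists>b b'.
       (\<forall>k\<in>freqs. \<forall>t. \<forall>\<omega>\<in>space M.
          \<beta> k t \<omega> = of_real (1 / sqrt 2) * of_real (b k t \<omega>)
                  + \<i> * of_real (1 / sqrt 2) * of_real (b' k t \<omega>)) \<and>
       (\<forall>k\<in>freqs. two_sided_fbm M H (b k) \<and> two_sided_fbm M H (b' k)) \<and>
       (\<forall>P\<subseteq>freqs. (\<forall>k\<in>P. - k \<notin> P) \<longrightarrow>
          prob_space.indep_vars M (\<lambda>_. \<Pi>\<^sub>M t\<in>(UNIV :: real set). borel)
            (\<lambda>(k, real_part) \<omega>. \<lambda>t. if real_part then b k t \<omega> else b' k t \<omega>)
            (P \<times> (UNIV :: bool set))))"

text \<open>Riemann-Stieltjes integral: the sums converge as the mesh tends to zero. The intervals of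
  the tagged divisions are compact, so \<open>Inf J\<close> and \<open>Sup J\<close> are the endpoints of \<open>J\<close>.\<close>

definition has_stieltjes_integral ::
  "(real \<Rightarrow> real) \<Rightarrow> (real \<Rightarrow> complex) \<Rightarrow> complex \<Rightarrow> real \<Rightarrow> real \<Rightarrow> bool" where
  "has_stieltjes_integral f g I a b \<longleftrightarrow>
     (\<forall>\<epsilon>>0. \<exists>\<delta>>0. \<forall>D. D tagged_division_of {a..b} \<and> (\<lambda>x. ball x \<delta>) fine D \<longrightarrow>
        dist (\<Sum>(x, J)\<in>D. f x *\<^sub>R (g (Sup J) - g (Inf J))) I < \<epsilon>)"

definition stieltjes_integral ::
  "(real \<Rightarrow> real) \<Rightarrow> (real \<Rightarrow> complex) \<Rightarrow> real \<Rightarrow> real \<Rightarrow> complex" where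
  "stieltjes_integral f g a b = (THE I. has_stieltjes_integral f g I a b)"

text \<open>The integral of \<open>exp (- (t - u) a)\<close> against \<open>d\<beta>(u)\<close> over \<open>u\<close> in \<open>(- \<infinity>, t]\<close>, taken path by
  path. For almost every path of a fractional Brownian motion it exists for all \<open>t\<close>, since the
  integrand is smooth and the path is continuous with sublinear growth, and it agrees almost
  surely with the corresponding Wiener integral.\<close>

definition ou_integral :: "real \<Rightarrow> (real \<Rightarrow> complex) \<Rightarrow> real \<Rightarrow> complex" where
  "ou_integral a \<beta> t = Lim at_bot (\<lambda>s. stieltjes_integral (\<lambda>u. exp (- (t - u) * a)) \<beta> s t)"

text \<open>\<open>\<psi>\<close> is a (real-valued) version of the ergodic mild solution of
  \<open>d\<psi> = \<nu> A \<psi> dt + \<nu>^H Q^(1/2) dB^H\<close>, where \<open>A\<close> and \<open>Q^(1/2)\<close> are diagonal in the Fourier basis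
  with eigenvalues \<open>- \<alpha> k\<close> and \<open>sqrt (\<Lambda> k)\<close>.\<close>

definition version_of_ergodic_mild_solution ::
  "'w measure \<Rightarrow> real \<Rightarrow> real \<Rightarrow> (real^2 \<Rightarrow> real) \<Rightarrow> (real^2 \<Rightarrow> real) \<Rightarrow>
   (real^2 \<Rightarrow> real \<Rightarrow> 'w \<Rightarrow> complex) \<Rightarrow> (real \<Rightarrow> torus \<Rightarrow> 'w \<Rightarrow> real) \<Rightarrow> bool" where
  "version_of_ergodic_mild_solution M H \<nu> \<alpha> \<Lambda> \<beta> \<psi> \<longleftrightarrow>
     (\<forall>t. AE \<omega> in M. has_fourier_sum (\<lambda>p. of_real (\<psi> t p \<omega>))
        (\<lambda>k. of_real (sqrt (\<Lambda> k)) * of_real (\<nu> powr H) *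
             ou_integral (\<nu> * \<alpha> k) (\<lambda>u. \<beta> k u \<omega>) t))"

end

theory Submission
  imports Defs
begin

text \<open>For almost every \<open>\<omega>\<close> the path of \<open>\<psi>\<close> is continuous in time with values in \<open>C^m\<close> of the torus, and for
such a path the assertion is a deterministic one about a flow.

On the universal covering \<open>plane \<times> plane\<close> of the phase space the field is
\<open>(x, y) \<mapsto> (y, (v(x, t) - y) / \<tau>)\<close> with \<open>v\<close> of class \<open>C^(m - 1)\<close> and periodic in \<open>x\<close>. Since
\<open>m - 1 \<ge> 1\<close> and the torus is compact, the first derivatives of \<open>v\<close> are bounded as long as time is, so
the field is globally Lipschitz in the state, locally uniformly in time. Picard iteration then
yields global solutions (\<open>global_ode_solution\<close>), and Gronwall's inequality (\<open>gronwall\<close>) their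
uniqueness.

The smoothness of the flow is \<open>solution_evolving_family\<close>, an induction on the order of
differentiability. The derivatives of a solution with respect to the initial value solve the
variational equation, whose right-hand side contains one derivative less. In order that the
variational equation is of the same kind as the original one, the induction treats equations
\<open>U' = F(t, p, U)\<close> with a parameter \<open>p\<close>: the solution whose derivative is taken enters the
variational equation only through its dependence on \<open>p\<close>. The time derivative is carried along in
the induction, since the space \<open>C^1(\<real>, C^n)\<close> demands that differentiation in time commutes with the
derivatives in the initial value.

It remains to compare curves in the phase space with curves in the covering. Differentiability of a
phase-valued curve is tested with local lifts that need not fit together, but the velocity is
a globally defined component of the curve, and its antiderivative is a global lift
(\<open>torus_phase_lift\<close>).\<close>

section \<open>Families of class \<open>C^n\<close> that depend continuously on time\<close>

text \<open>The derivative is total; it is encoded by its values on the basis because these are families of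
the same type as \<open>u\<close>, so that an induction on the order of differentiability stays within one type.\<close>

definition has_partials ::
  "(real \<Rightarrow> 'a::euclidean_space \<Rightarrow> 'b::real_normed_vector) \<Rightarrow> ('a \<Rightarrow> real \<Rightarrow> 'a \<Rightarrow> 'b) \<Rightarrow> bool"
where
  "has_partials u u' \<longleftrightarrow>
     (\<forall>t x. (u t has_derivative (\<lambda>h. \<Sum>i\<in>Basis. (h \<bullet> i) *\<^sub>R u' i t x)) (at x))"

text \<open>Continuity in time with values in \<open>C^n\<close>. Joint continuity of the partial derivatives is equivalent
to locally uniform convergence, since the space is locally compact, and the recursion on the order
reduces the closure properties below to the sum, product and chain rules.\<close>

primrec smooth_family ::
  "nat \<Rightarrow> (real \<Rightarrow> 'a::euclidean_space \<Rightarrow> 'b::real_normed_vector) \<Rightarrow> bool"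
where
  "smooth_family 0 u = continuous_on UNIV (\<lambda>(t, x). u t x)"
| "smooth_family (Suc n) u = (continuous_on UNIV (\<lambda>(t, x). u t x) \<and>
     (\<exists>u'. has_partials u u' \<and> (\<forall>i\<in>Basis. smooth_family n (u' i))))"

lemma has_partialsD:
  "has_partials u u' \<Longrightarrow> (u t has_derivative (\<lambda>h. \<Sum>i\<in>Basis. (h \<bullet> i) *\<^sub>R u' i t x)) (at x)"
  by (simp add: has_partials_def)

lemma smooth_family_continuous:
  "smooth_family n u \<Longrightarrow> continuous_on UNIV (\<lambda>(t, x). u t x)"
  by (cases n) auto

lemma smooth_family_SucI:
  assumes "continuous_on UNIV (\<lambda>(t, x). u t x)"
    and "\<And>t x. (u t has_derivative (\<lambda>h. \<Sum>i\<in>Basis. (h \<bullet> i) *\<^sub>R u' i t x)) (at x)"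
    and "\<And>i. i \<in> Basis \<Longrightarrow> smooth_family n (u' i)"
  shows "smooth_family (Suc n) u"
  using assms by (auto simp: has_partials_def)

lemmas smooth_family_Suc_partials = iffD1[OF smooth_family.simps(2)]

lemma smooth_family_SucD: "smooth_family (Suc n) u \<Longrightarrow> smooth_family n u"
proof (induction n arbitrary: u)
  case (Suc n)
  obtain u' where u': "continuous_on UNIV (\<lambda>(t, x). u t x)"
    "has_partials u u'"
    "\<And>i. i \<in> Basis \<Longrightarrow> smooth_family (Suc n) (u' i)"
    using smooth_family_Suc_partials[OF Suc.prems] by blast
  show ?case
    using u'(3)[THEN Suc.IH] by (rule smooth_family_SucI[OF u'(1) has_partialsD[OF u'(2)]])
qed auto

lemma smooth_family_mono: "smooth_family n u \<Longrightarrow> m \<le> n \<Longrightarrow> smooth_family m u"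
  by (induction n) (auto simp: le_Suc_eq dest: smooth_family_SucD simp del: smooth_family.simps)

lemma smooth_family_const: "smooth_family n (\<lambda>t x. c)"
proof (induction n arbitrary: c)
  case (Suc n)
  show ?case
    by (rule smooth_family_SucI[where u' = "\<lambda>_ _ _. 0"]) (use Suc.IH in auto)
qed simp

lemma smooth_family_bounded_linear:
  assumes "bounded_linear L"
  shows "smooth_family n u \<Longrightarrow> smooth_family n (\<lambda>t x. L (u t x))"
proof (induction n arbitrary: u)
  case 0
  then show ?case
    using bounded_linear.continuous_on[OF assms] by (fastforce simp: case_prod_beta)
next
  case (Suc n)
  interpret bounded_linear L by fact
  obtain u' where u': "continuous_on UNIV (\<lambda>(t, x). u t x)"
    "has_partials u u'"
    "\<And>i. i \<in> Basis \<Longrightarrow> smooth_family n (u' i)"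
    using smooth_family_Suc_partials[OF Suc.prems] by blast
  show ?case
  proof (rule smooth_family_SucI[where u' = "\<lambda>i t x. L (u' i t x)"])
    show "continuous_on UNIV (\<lambda>(t, x). L (u t x))"
      using continuous_on[OF u'(1)] by (simp add: case_prod_beta)
    show "((\<lambda>x. L (u t x)) has_derivative (\<lambda>h. \<Sum>i\<in>Basis. (h \<bullet> i) *\<^sub>R L (u' i t x))) (at x)"
      for t x
      using has_derivative[OF has_partialsD[OF u'(2), of t x]] by (simp add: sum scaleR)
  qed (use u'(3) Suc.IH in auto)
qed

lemma smooth_family_add:
  "smooth_family n u \<Longrightarrow> smooth_family n v \<Longrightarrow> smooth_family n (\<lambda>t x. u t x + v t x)"
proof (induction n arbitrary: u v)
  case 0
  then show ?case by (auto simp: case_prod_beta intro: continuous_on_add)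
next
  case (Suc n)
  obtain u' where u': "continuous_on UNIV (\<lambda>(t, x). u t x)"
    "has_partials u u'"
    "\<And>i. i \<in> Basis \<Longrightarrow> smooth_family n (u' i)"
    using smooth_family_Suc_partials[OF Suc.prems(1)] by blast
  obtain v' where v': "continuous_on UNIV (\<lambda>(t, x). v t x)"
    "has_partials v v'"
    "\<And>i. i \<in> Basis \<Longrightarrow> smooth_family n (v' i)"
    using smooth_family_Suc_partials[OF Suc.prems(2)] by blast
  show ?case
  proof (rule smooth_family_SucI[where u' = "\<lambda>i t x. u' i t x + v' i t x"])
    show "continuous_on UNIV (\<lambda>(t, x). u t x + v t x)"
      using u'(1) v'(1) by (auto simp: case_prod_beta intro: continuous_on_add)
    show "((\<lambda>x. u t x + v t x) has_derivative
        (\<lambda>h. \<Sum>i\<in>Basis. (h \<bullet> i) *\<^sub>R (u' i t x + v' i t x))) (at x)" for t x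
      using has_derivative_add[OF has_partialsD[OF u'(2), of t x] has_partialsD[OF v'(2), of t x]]
      by (simp add: scaleR_add_right sum.distrib)
  qed (use u'(3) v'(3) Suc.IH in auto)
qed

lemma smooth_family_sum:
  "(\<And>j. j \<in> J \<Longrightarrow> smooth_family n (u j)) \<Longrightarrow> smooth_family n (\<lambda>t x. \<Sum>j\<in>J. u j t x)"
  by (induction J rule: infinite_finite_induct)
    (simp_all add: smooth_family_const smooth_family_add del: smooth_family.simps)

lemma smooth_family_scaleR:
  fixes r :: "real \<Rightarrow> 'a::euclidean_space \<Rightarrow> real"
  shows "smooth_family n r \<Longrightarrow> smooth_family n u \<Longrightarrow> smooth_family n (\<lambda>t x. r t x *\<^sub>R u t x)"
proof (induction n arbitrary: r u)
  case 0
  then show ?case by (auto simp: case_prod_beta intro: continuous_on_scaleR)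
next
  case (Suc n)
  obtain r' where r': "continuous_on UNIV (\<lambda>(t, x). r t x)"
    "has_partials r r'"
    "\<And>i. i \<in> Basis \<Longrightarrow> smooth_family n (r' i)"
    using smooth_family_Suc_partials[OF Suc.prems(1)] by blast
  obtain u' where u': "continuous_on UNIV (\<lambda>(t, x). u t x)"
    "has_partials u u'"
    "\<And>i. i \<in> Basis \<Longrightarrow> smooth_family n (u' i)"
    using smooth_family_Suc_partials[OF Suc.prems(2)] by blast
  show ?case
  proof (rule smooth_family_SucI[where u' = "\<lambda>i t x. r t x *\<^sub>R u' i t x + r' i t x *\<^sub>R u t x"])
    show "continuous_on UNIV (\<lambda>(t, x). r t x *\<^sub>R u t x)"
      using r'(1) u'(1) by (auto simp: case_prod_beta intro: continuous_on_scaleR)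
    show "((\<lambda>x. r t x *\<^sub>R u t x) has_derivative
        (\<lambda>h. \<Sum>i\<in>Basis. (h \<bullet> i) *\<^sub>R (r t x *\<^sub>R u' i t x + r' i t x *\<^sub>R u t x))) (at x)" for t x
      by (rule has_derivative_eq_rhs[OF has_derivative_scaleR[OF has_partialsD[OF r'(2), of t x] has_partialsD[OF u'(2), of t x]]])
        (simp add: fun_eq_iff scaleR_add_right sum.distrib scaleR_sum_right scaleR_sum_left mult.commute)
    show "smooth_family n (\<lambda>t x. r t x *\<^sub>R u' i t x + r' i t x *\<^sub>R u t x)" if "i \<in> Basis" for i
      using that Suc.prems[THEN smooth_family_SucD] r'(3) u'(3)
      by (intro smooth_family_add Suc.IH)
  qed
qed

lemma smooth_family_linear:
  fixes L :: "'a::euclidean_space \<Rightarrow> 'b::real_normed_vector"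
  assumes "bounded_linear L"
  shows "smooth_family n (\<lambda>t. L)"
proof -
  interpret bounded_linear L by fact
  have cont: "continuous_on UNIV (\<lambda>(t::real, x). L x)"
    using continuous_on[OF continuous_on_snd[OF continuous_on_id]] by (simp add: case_prod_beta)
  show ?thesis
  proof (cases n)
    case (Suc k)
    show ?thesis unfolding Suc
    proof (rule smooth_family_SucI[where u' = "\<lambda>i t x. L i", OF cont])
      have "(\<lambda>h. \<Sum>i\<in>Basis. (h \<bullet> i) *\<^sub>R L i) = L"
        by (rule ext) (simp add: sum[symmetric] scaleR[symmetric] euclidean_representation)
      then show "(L has_derivative (\<lambda>h. \<Sum>i\<in>Basis. (h \<bullet> i) *\<^sub>R L i)) (at x)" for x
        using bounded_linear_imp_has_derivative[OF assms] by simp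
    qed (rule smooth_family_const)
  qed (use cont in simp)
qed

lemma smooth_family_Pair:
  assumes "smooth_family n u" "smooth_family n v"
  shows "smooth_family n (\<lambda>t x. (u t x, v t x))"
proof -
  have "smooth_family n (\<lambda>t x. (u t x, 0) + (0, v t x))"
    by (intro smooth_family_add smooth_family_bounded_linear[of "\<lambda>a. (a, 0)"]
        smooth_family_bounded_linear[of "\<lambda>b. (0, b)"] assms bounded_linear_Pair
        bounded_linear_ident bounded_linear_zero)
  then show ?thesis by simp
qed

lemma continuous_on_compose_family:
  assumes f: "continuous_on UNIV (\<lambda>(t, x). f t x)" and u: "continuous_on UNIV (\<lambda>(t, x). u t x)"
  shows "continuous_on UNIV (\<lambda>(t, x). f t (u t x))"
proof -
  have "continuous_on UNIV (\<lambda>z. (fst z, case_prod u z))"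
    using continuous_on_Pair[OF continuous_on_fst[OF continuous_on_id] u] by simp
  then have "continuous_on UNIV (\<lambda>z. case_prod f (fst z, case_prod u z))"
    using continuous_on_compose2[OF f] by blast
  then show ?thesis by (simp add: case_prod_beta)
qed

lemma smooth_family_compose:
  fixes f :: "real \<Rightarrow> 'e::euclidean_space \<Rightarrow> 'b::real_normed_vector"
    and u :: "real \<Rightarrow> 'a::euclidean_space \<Rightarrow> 'e"
  shows "smooth_family n f \<Longrightarrow> smooth_family n u \<Longrightarrow> smooth_family n (\<lambda>t x. f t (u t x))"
proof (induction n arbitrary: f)
  case 0
  then show ?case using continuous_on_compose_family by auto
next
  case (Suc n)
  obtain f' where f': "continuous_on UNIV (\<lambda>(t, x). f t x)"
    "has_partials f f'"
    "\<And>i. i \<in> Basis \<Longrightarrow> smooth_family n (f' i)"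
    using smooth_family_Suc_partials[OF Suc.prems(1)] by blast
  obtain u' where u': "continuous_on UNIV (\<lambda>(t, x). u t x)"
    "has_partials u u'"
    "\<And>i. i \<in> Basis \<Longrightarrow> smooth_family n (u' i)"
    using smooth_family_Suc_partials[OF Suc.prems(2)] by blast
  show ?case
  proof (rule smooth_family_SucI[where u' = "\<lambda>i t x. \<Sum>j\<in>Basis. (u' i t x \<bullet> j) *\<^sub>R f' j t (u t x)"])
    show "continuous_on UNIV (\<lambda>(t, x). f t (u t x))"
      using f'(1) u'(1) by (rule continuous_on_compose_family)
    show "((\<lambda>x. f t (u t x)) has_derivative
        (\<lambda>h. \<Sum>i\<in>Basis. (h \<bullet> i) *\<^sub>R (\<Sum>j\<in>Basis. (u' i t x \<bullet> j) *\<^sub>R f' j t (u t x)))) (at x)" for t x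
    proof (rule has_derivative_eq_rhs[OF has_derivative_compose[OF has_partialsD[OF u'(2)] has_partialsD[OF f'(2)]]], rule ext)
      fix h :: 'a
      show "(\<Sum>j\<in>Basis. ((\<Sum>i\<in>Basis. (h \<bullet> i) *\<^sub>R u' i t x) \<bullet> j) *\<^sub>R f' j t (u t x)) =
        (\<Sum>i\<in>Basis. (h \<bullet> i) *\<^sub>R (\<Sum>j\<in>Basis. (u' i t x \<bullet> j) *\<^sub>R f' j t (u t x)))"
        by (simp add: inner_sum_left scaleR_sum_left scaleR_sum_right) (rule sum.swap)
    qed
    show "smooth_family n (\<lambda>t x. \<Sum>j\<in>Basis. (u' i t x \<bullet> j) *\<^sub>R f' j t (u t x))"
      if "i \<in> Basis" for i
    proof (intro smooth_family_sum smooth_family_scaleR)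
      fix j :: 'e assume "j \<in> Basis"
      then show "smooth_family n (\<lambda>t x. f' j t (u t x))"
        using Suc.IH[OF f'(3) smooth_family_SucD[OF Suc.prems(2)]] by blast
      show "smooth_family n (\<lambda>t x. u' i t x \<bullet> j)"
        using smooth_family_bounded_linear[OF bounded_linear_inner_left u'(3)[OF that]] .
    qed
  qed
qed

section \<open>Gronwall's inequality and global solutions of Lipschitz equations\<close>

text \<open>The estimate is carried out for the square of the norm, which is differentiable also where \<open>R\<close>
vanishes: \<open>2 a \<bar>R\<bar>\<^sup>2 + 2 b \<bar>R\<bar> \<le> (2 a + 1) \<bar>R\<bar>\<^sup>2 + b\<^sup>2\<close>. The exponent \<open>a + 1\<close> is not sharp; it absorbs
both this and the factor \<open>1 + t\<close> that comes from integrating \<open>b\<^sup>2\<close>.\<close>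

lemma gronwall_nonneg:
  fixes R :: "real \<Rightarrow> 'a::real_inner"
  assumes R': "\<And>s. 0 \<le> s \<Longrightarrow> s \<le> t \<Longrightarrow> (R has_vector_derivative R' s) (at s)"
    and bnd: "\<And>s. 0 \<le> s \<Longrightarrow> s \<le> t \<Longrightarrow> norm (R' s) \<le> a * norm (R s) + b"
    and "0 \<le> t" "0 \<le> a" "0 \<le> b"
  shows "norm (R t) \<le> exp ((a + 1) * t) * (norm (R 0) + b)"
proof -
  define z where "z s = exp (- (2 * a + 1) * s) * (R s \<bullet> R s) - b\<^sup>2 * s" for s
  have "z t \<le> z 0"
  proof (rule DERIV_nonpos_imp_nonincreasing[OF \<open>0 \<le> t\<close>])
    fix s assume s: "0 \<le> s" "s \<le> t"
    define y where "y = exp (- (2 * a + 1) * s)"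
    have "(z has_real_derivative
        y * (2 * (R s \<bullet> R' s) - (2 * a + 1) * (R s \<bullet> R s)) - b\<^sup>2) (at s)"
      using R'[OF s] unfolding z_def y_def has_real_derivative_iff_has_vector_derivative
      apply -
      unfolding has_vector_derivative_def
      by (auto intro!: derivative_eq_intros simp: algebra_simps inner_commute fun_eq_iff)
    moreover have "2 * (R s \<bullet> R' s) - (2 * a + 1) * (R s \<bullet> R s) \<le> b\<^sup>2"
    proof -
      have "R s \<bullet> R' s \<le> norm (R s) * (a * norm (R s) + b)"
        using norm_cauchy_schwarz[of "R s" "R' s"] mult_left_mono[OF bnd[OF s] norm_ge_zero[of "R s"]]
        by linarith
      moreover have "0 \<le> (norm (R s) - b)\<^sup>2" by simp
      ultimately show ?thesis
        by (simp add: dot_square_norm power2_eq_square algebra_simps)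
    qed
    then have "y * (2 * (R s \<bullet> R' s) - (2 * a + 1) * (R s \<bullet> R s)) \<le> 1 * b\<^sup>2"
    proof -
      assume *: "2 * (R s \<bullet> R' s) - (2 * a + 1) * (R s \<bullet> R s) \<le> b\<^sup>2"
      have "y = exp (- ((2 * a + 1) * s))" by (simp add: y_def algebra_simps)
      then have "0 \<le> y" "y \<le> 1"
        using mult_nonneg_nonneg[of "2 * a + 1" s] s \<open>0 \<le> a\<close> by auto
      then show ?thesis using mult_left_mono[OF *, of y] mult_right_mono[of y 1 "b\<^sup>2"] by simp
    qed
    ultimately show "\<exists>y. (z has_real_derivative y) (at s) \<and> y \<le> 0" by force
  qed
  then have "exp (- (2 * a + 1) * t) * (norm (R t))\<^sup>2 \<le> (norm (R 0))\<^sup>2 + b\<^sup>2 * t"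
    by (simp add: z_def dot_square_norm)
  then have "exp ((2 * a + 1) * t) * (exp (- (2 * a + 1) * t) * (norm (R t))\<^sup>2)
      \<le> exp ((2 * a + 1) * t) * ((norm (R 0))\<^sup>2 + b\<^sup>2 * t)"
    by (rule mult_left_mono) simp
  then have "(norm (R t))\<^sup>2 \<le> exp ((2 * a + 1) * t) * ((norm (R 0))\<^sup>2 + b\<^sup>2 * t)"
  proof -
    have "exp ((2 * a + 1) * t) * exp (- (2 * a + 1) * t) = 1"
      by (simp add: mult_exp_exp) (simp add: algebra_simps)
    then have "exp ((2 * a + 1) * t) * (exp (- (2 * a + 1) * t) * (norm (R t))\<^sup>2) = (norm (R t))\<^sup>2"
      by (metis mult.assoc mult_1)
    moreover assume "exp ((2 * a + 1) * t) * (exp (- (2 * a + 1) * t) * (norm (R t))\<^sup>2)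
        \<le> exp ((2 * a + 1) * t) * ((norm (R 0))\<^sup>2 + b\<^sup>2 * t)"
    ultimately show "(norm (R t))\<^sup>2 \<le> exp ((2 * a + 1) * t) * ((norm (R 0))\<^sup>2 + b\<^sup>2 * t)"
      by (simp only:)
  qed
  also have "\<dots> \<le> exp ((2 * a + 1) * t) * (exp t * (norm (R 0) + b)\<^sup>2)"
  proof (rule mult_left_mono)
    have "(norm (R 0))\<^sup>2 + b\<^sup>2 * t \<le> (1 + t) * (norm (R 0) + b)\<^sup>2"
      using \<open>0 \<le> t\<close> \<open>0 \<le> b\<close> by (simp add: power2_eq_square algebra_simps)
    also have "\<dots> \<le> exp t * (norm (R 0) + b)\<^sup>2"
      by (intro mult_right_mono) auto
    finally show "(norm (R 0))\<^sup>2 + b\<^sup>2 * t \<le> exp t * (norm (R 0) + b)\<^sup>2" .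
  qed simp
  also have "\<dots> = (exp ((a + 1) * t) * (norm (R 0) + b))\<^sup>2"
  proof -
    have "exp ((2 * a + 1) * t) * exp t = (exp ((a + 1) * t))\<^sup>2"
      by (simp add: mult_exp_exp power2_eq_square) (simp add: algebra_simps)
    then show ?thesis by (metis mult.assoc power_mult_distrib)
  qed
  finally show ?thesis
    by (rule power2_le_imp_le) (use \<open>0 \<le> b\<close> in simp)
qed

lemma gronwall:
  fixes R :: "real \<Rightarrow> 'a::real_inner"
  assumes R': "\<And>s. \<bar>s\<bar> \<le> T \<Longrightarrow> (R has_vector_derivative R' s) (at s)"
    and bnd: "\<And>s. \<bar>s\<bar> \<le> T \<Longrightarrow> norm (R' s) \<le> a * norm (R s) + b"
    and t: "\<bar>t\<bar> \<le> T" and "0 \<le> a" "0 \<le> b"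
  shows "norm (R t) \<le> exp ((a + 1) * T) * (norm (R 0) + b)"
proof -
  have "norm (R t) \<le> exp ((a + 1) * \<bar>t\<bar>) * (norm (R 0) + b)"
  proof (cases "0 \<le> t")
    case True
    then show ?thesis
      using gronwall_nonneg[of t R R' a b] assms by simp
  next
    case False
    have "norm ((\<lambda>s. R (- s)) (- t)) \<le> exp ((a + 1) * - t) * (norm ((\<lambda>s. R (- s)) 0) + b)"
    proof (rule gronwall_nonneg[where R' = "\<lambda>s. - R' (- s)"])
      show "((\<lambda>s. R (- s)) has_vector_derivative - R' (- s)) (at s)"
        if "0 \<le> s" "s \<le> - t" for s
        using vector_diff_chain_at[OF has_vector_derivative_minus[OF has_vector_derivative_id], of R "R' (- s)" s] R'[of "- s"] that t
        by (simp add: o_def)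
    qed (use False assms in auto)
    then show ?thesis using False by simp
  qed
  also have "\<dots> \<le> exp ((a + 1) * T) * (norm (R 0) + b)"
    using assms by (intro mult_right_mono) (auto intro: mult_left_mono)
  finally show ?thesis .
qed

text \<open>The functions bounded by a multiple of \<open>exp (\<kappa> \<bar>s\<bar>)\<close> lose a factor \<open>\<kappa>\<close> under integration from 0.
With \<open>\<kappa> = 2 L\<close> an integral operator of Lipschitz constant \<open>L\<close> becomes a contraction by one half.\<close>

lemma norm_le_exp_of_derivative_nonneg:
  fixes d :: "real \<Rightarrow> 'a::real_normed_vector"
  assumes d': "\<And>s. 0 \<le> s \<Longrightarrow> s \<le> t \<Longrightarrow> (d has_vector_derivative d' s) (at s)"
    and bnd: "\<And>s. 0 \<le> s \<Longrightarrow> s \<le> t \<Longrightarrow> norm (d' s) \<le> \<kappa> * C * exp (\<kappa> * s)"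
    and "d 0 = 0" "0 \<le> t" "0 \<le> C"
  shows "norm (d t) \<le> C * exp (\<kappa> * t)"
proof (cases "t = 0")
  case False
  with \<open>0 \<le> t\<close> have "0 < t" by simp
  have "norm (d t - d 0) \<le> C * exp (\<kappa> * t) - C * exp (\<kappa> * 0)"
  proof (rule differentiable_bound_general[OF \<open>0 < t\<close>])
    show "continuous_on {0..t} d"
      using d' by (meson atLeastAtMost_iff continuous_at_imp_continuous_on has_vector_derivative_continuous)
    show "((\<lambda>t. C * exp (\<kappa> * t)) has_vector_derivative \<kappa> * C * exp (\<kappa> * s)) (at s)" for s
      unfolding has_real_derivative_iff_has_vector_derivative[symmetric]
      by (auto intro!: derivative_eq_intros)
  qed (auto intro!: continuous_intros d' bnd)
  then show ?thesis using \<open>d 0 = 0\<close> \<open>0 \<le> C\<close> by simp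
qed (use assms in simp)

lemma norm_le_exp_of_derivative:
  fixes d :: "real \<Rightarrow> 'a::real_normed_vector"
  assumes d': "\<And>s. \<bar>s\<bar> \<le> T \<Longrightarrow> (d has_vector_derivative d' s) (at s)"
    and bnd: "\<And>s. \<bar>s\<bar> \<le> T \<Longrightarrow> norm (d' s) \<le> \<kappa> * C * exp (\<kappa> * \<bar>s\<bar>)"
    and "d 0 = 0" "\<bar>t\<bar> \<le> T" "0 \<le> C"
  shows "norm (d t) \<le> C * exp (\<kappa> * \<bar>t\<bar>)"
proof (cases "0 \<le> t")
  case True
  have "norm (d t) \<le> C * exp (\<kappa> * t)"
  proof (rule norm_le_exp_of_derivative_nonneg[where d' = d'])
    show "norm (d' s) \<le> \<kappa> * C * exp (\<kappa> * s)" if "0 \<le> s" "s \<le> t" for s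
      using bnd[of s] that assms by simp
  qed (use True assms in auto)
  then show ?thesis using True by simp
next
  case False
  have "norm ((\<lambda>s. d (- s)) (- t)) \<le> C * exp (\<kappa> * - t)"
  proof (rule norm_le_exp_of_derivative_nonneg[where d' = "\<lambda>s. - d' (- s)"])
    show "((\<lambda>s. d (- s)) has_vector_derivative - d' (- s)) (at s)" if "0 \<le> s" "s \<le> - t" for s
      using vector_diff_chain_at[OF has_vector_derivative_minus[OF has_vector_derivative_id], of d "d' (- s)" s] d'[of "- s"] that assms
      by (simp add: o_def)
    show "norm (- d' (- s)) \<le> \<kappa> * C * exp (\<kappa> * s)" if "0 \<le> s" "s \<le> - t" for s
      using bnd[of "- s"] that assms by simp
  qed (use False assms in auto)
  then show ?thesis using False by simp
qed

lemma continuous_antiderivative: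
  fixes h :: "real \<Rightarrow> 'a::euclidean_space"
  assumes "continuous_on UNIV h"
  obtains F where "F 0 = c" "\<And>t. (F has_vector_derivative h t) (at t)"
proof -
  have "\<exists>F. \<forall>x::real. - \<infinity> < ereal x \<longrightarrow> ereal x < \<infinity> \<longrightarrow> (F has_vector_derivative h x) (at x)"
    using assms by (intro einterval_antiderivative) (auto simp: continuous_on_eq_continuous_at)
  then obtain F where F: "\<And>t. (F has_vector_derivative h t) (at t)" by auto
  show ?thesis
    by (rule that[of "\<lambda>t. F t - F 0 + c"]) (auto intro!: derivative_eq_intros F)
qed

text \<open>Picard iteration. By the choice of the weight \<open>exp (2 L \<bar>t\<bar>)\<close> consecutive iterates differ by
\<open>O(2^(-n))\<close> uniformly on every bounded interval, whatever its length; hence the iterates, which are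
defined for all times, converge locally uniformly on the whole line.\<close>

theorem global_ode_solution:
  fixes f :: "real \<Rightarrow> 'a::euclidean_space \<Rightarrow> 'a"
  assumes cont: "continuous_on UNIV (\<lambda>(t, x). f t x)"
    and lip: "\<And>T. \<exists>L. \<forall>t x y. \<bar>t\<bar> \<le> T \<longrightarrow> norm (f t x - f t y) \<le> L * norm (x - y)"
  obtains u where "u 0 = c" "\<And>t. (u has_vector_derivative f t (u t)) (at t)"
proof -
  have cont_f: "continuous_on UNIV (\<lambda>t. f t (v t))" if "continuous_on UNIV v" for v
    using continuous_on_compose2[OF cont continuous_on_Pair[OF continuous_on_id that]] by simp
  \<comment> \<open>The iteration starts from an arbitrary continuous function; the initial value is attained from
    the first iterate on.\<close>
  have "\<exists>u. \<forall>n. continuous_on UNIV (u n) \<and>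
      u (Suc n) 0 = c \<and> (\<forall>t. (u (Suc n) has_vector_derivative f t (u n t)) (at t))"
  proof (rule dependent_nat_choice)
    show "\<exists>v :: real \<Rightarrow> 'a. continuous_on UNIV v" by (rule exI[of _ "\<lambda>_. 0"]) (rule continuous_on_const)
    fix v :: "real \<Rightarrow> 'a" and n :: nat assume "continuous_on UNIV v"
    then obtain w where w: "w 0 = c" "\<And>t. (w has_vector_derivative f t (v t)) (at t)"
      using continuous_antiderivative[OF cont_f, of v c] by blast
    moreover have "continuous_on UNIV w"
      using w(2) by (meson continuous_at_imp_continuous_on has_vector_derivative_continuous)
    ultimately show "\<exists>w. continuous_on UNIV w \<and>
        w 0 = c \<and> (\<forall>t. (w has_vector_derivative f t (v t)) (at t))" by blast
  qed
  then obtain u where u_cont: "\<And>n. continuous_on UNIV (u n)" and u0: "\<And>n. u (Suc n) 0 = c"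
    and u': "\<And>n t. (u (Suc n) has_vector_derivative f t (u n t)) (at t)" by blast
  define v where "v t = u 0 t + (\<Sum>n. u (Suc n) t - u n t)" for t
  have unif: "uniform_limit {-T<..<T} u v sequentially" if "0 < T" for T
  proof -
    obtain L0 where L0: "\<And>t x y. \<bar>t\<bar> \<le> T \<Longrightarrow> norm (f t x - f t y) \<le> L0 * norm (x - y)"
      using lip[of T] by blast
    define L where "L = max L0 0"
    have L: "norm (f t x - f t y) \<le> L * norm (x - y)" if "\<bar>t\<bar> \<le> T" for t x y
      using L0[OF that, of x y] mult_right_mono[of L0 L "norm (x - y)"] by (auto simp: L_def)
    have "compact ((\<lambda>t. u 1 t - u 0 t) ` {-T..T})"
      by (intro compact_continuous_image continuous_on_diff continuous_on_subset[OF u_cont]) auto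
    then obtain M where "\<forall>y\<in>(\<lambda>t. u 1 t - u 0 t) ` {-T..T}. norm y \<le> M"
      using compact_imp_bounded bounded_iff by blast
    then have M: "norm (u 1 t - u 0 t) \<le> M" if "\<bar>t\<bar> \<le> T" for t
      using that by (auto simp: abs_le_iff)
    have M0: "0 \<le> M" using M[of 0] that norm_ge_zero[of "u 1 0 - u 0 0"] by linarith
    have step: "norm (u (Suc n) t - u n t) \<le> M / 2 ^ n * exp (2 * L * \<bar>t\<bar>)" if "\<bar>t\<bar> \<le> T" for n t
      using that
    proof (induction n arbitrary: t)
      case 0
      have "M * 1 \<le> M * exp (2 * L * \<bar>t\<bar>)"
        using M0 by (intro mult_left_mono) (auto simp: L_def)
      then show ?case using M[OF 0] by simp
    next
      case (Suc n)
      show ?case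
      proof (rule norm_le_exp_of_derivative[where T = T])
        fix s assume s: "\<bar>s\<bar> \<le> T"
        show "((\<lambda>s. u (Suc (Suc n)) s - u (Suc n) s) has_vector_derivative
            f s (u (Suc n) s) - f s (u n s)) (at s)"
          by (intro has_vector_derivative_diff u')
        have "norm (f s (u (Suc n) s) - f s (u n s)) \<le> L * (M / 2 ^ n * exp (2 * L * \<bar>s\<bar>))"
          by (rule order_trans[OF L[OF s] mult_left_mono[OF Suc.IH[OF s]]]) (simp add: L_def)
        then show "norm (f s (u (Suc n) s) - f s (u n s)) \<le>
            2 * L * (M / 2 ^ Suc n) * exp (2 * L * \<bar>s\<bar>)"
          by (simp add: field_simps)
      qed (use u0 Suc.prems M0 in auto)
    qed
    have bound: "norm (u (Suc n) t - u n t) \<le> M * exp (2 * L * T) * (1 / 2) ^ n"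
      if "t \<in> {-T<..<T}" for n t
    proof -
      have "M / 2 ^ n * exp (2 * L * \<bar>t\<bar>) \<le> M / 2 ^ n * exp (2 * L * T)"
        using that M0 by (intro mult_left_mono) (auto simp: L_def intro!: mult_left_mono)
      moreover have "\<bar>t\<bar> \<le> T" using that by auto
      ultimately have "norm (u (Suc n) t - u n t) \<le> M / 2 ^ n * exp (2 * L * T)"
        using order_trans[OF step] by blast
      then show ?thesis by (simp add: power_divide)
    qed
    have "uniform_limit {-T<..<T} (\<lambda>n t. \<Sum>i<n. u (Suc i) t - u i t)
        (\<lambda>t. \<Sum>n. u (Suc n) t - u n t) sequentially"
      by (rule Weierstrass_m_test[OF bound]) (auto intro!: summable_mult summable_geometric)
    then have "uniform_limit {-T<..<T} (\<lambda>n t. u 0 t + (\<Sum>i<n. u (Suc i) t - u i t)) v sequentially"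
      unfolding v_def by (intro uniform_limit_add uniform_limit_const)
    moreover have "(\<Sum>i<n. u (Suc i) t - u i t) = u n t - u 0 t" for n t
      using sum_lessThan_telescope[of "\<lambda>i. u i t"] by simp
    ultimately show ?thesis by simp
  qed
  have lim: "(\<lambda>n. u n t) \<longlonglongrightarrow> v t" for t
  proof -
    have "- (\<bar>t\<bar> + 1) < t" "t < \<bar>t\<bar> + 1" by linarith+
    then show ?thesis using tendsto_uniform_limitI[OF unif[of "\<bar>t\<bar> + 1"], of t] by simp
  qed
  have "v 0 = c"
    using LIMSEQ_unique[OF LIMSEQ_Suc[OF lim[of 0]]] u0 by simp
  moreover have "(v has_vector_derivative f t (v t)) (at t)" for t
  proof -
    define T where "T = \<bar>t\<bar> + 1"
    have T: "0 < T" "t \<in> {-T<..<T}" unfolding T_def greaterThanLessThan_iff by linarith+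
    obtain L0 where L0: "\<And>t x y. \<bar>t\<bar> \<le> T \<Longrightarrow> norm (f t x - f t y) \<le> L0 * norm (x - y)"
      using lip[of T] by blast
    define L where "L = max L0 1"
    have L: "norm (f t x - f t y) \<le> L * norm (x - y)" if "\<bar>t\<bar> \<le> T" for t x y
      using L0[OF that, of x y] mult_right_mono[of L0 L "norm (x - y)"] by (auto simp: L_def)
    have "\<exists>g. \<forall>x\<in>{-T<..<T}. (\<lambda>n. u (Suc n) x) \<longlonglongrightarrow> g x \<and>
        (g has_derivative (\<lambda>h. h *\<^sub>R f x (v x))) (at x within {-T<..<T})"
    proof (rule has_derivative_sequence[where f' = "\<lambda>n x h. h *\<^sub>R f x (u n x)"])
      show "(u (Suc n) has_derivative (\<lambda>h. h *\<^sub>R f x (u n x))) (at x within {-T<..<T})" for n x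
        using has_vector_derivative_at_within[OF u'[of n x]] by (simp add: has_vector_derivative_def)
      fix e :: real assume "0 < e"
      then have "\<forall>\<^sub>F n in sequentially. \<forall>x\<in>{-T<..<T}. dist (u n x) (v x) < e / L"
        using uniform_limitD[OF unif[OF T(1)], of "e / L"] by (simp add: L_def)
      then show "\<forall>\<^sub>F n in sequentially. \<forall>x\<in>{-T<..<T}. \<forall>h.
          norm (h *\<^sub>R f x (u n x) - h *\<^sub>R f x (v x)) \<le> e * norm h"
      proof (rule eventually_mono, intro ballI allI)
        fix n x h assume *: "\<forall>x\<in>{-T<..<T}. dist (u n x) (v x) < e / L" and x: "x \<in> {-T<..<T}"
        have "norm (f x (u n x) - f x (v x)) \<le> L * norm (u n x - v x)"
          using x by (intro L) auto
        also have "\<dots> \<le> L * (e / L)"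
          using *[rule_format, OF x] by (intro mult_left_mono) (auto simp: dist_norm L_def)
        finally have "norm (f x (u n x) - f x (v x)) \<le> e" by (simp add: L_def split: if_splits)
        then show "norm (h *\<^sub>R f x (u n x) - h *\<^sub>R f x (v x)) \<le> e * norm h"
          using mult_left_mono[of _ e "\<bar>h\<bar>"]
          by (simp add: scaleR_diff_right[symmetric] mult.commute[of e])
      qed
    qed (use T lim[THEN LIMSEQ_Suc] in auto)
    then obtain g where g: "\<And>x. x \<in> {-T<..<T} \<Longrightarrow> (\<lambda>n. u (Suc n) x) \<longlonglongrightarrow> g x"
      "\<And>x. x \<in> {-T<..<T} \<Longrightarrow> (g has_derivative (\<lambda>h. h *\<^sub>R f x (v x))) (at x within {-T<..<T})"
      by blast
    have "g x = v x" if "x \<in> {-T<..<T}" for x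
      using LIMSEQ_unique[OF g(1)[OF that] LIMSEQ_Suc[OF lim]] .
    moreover have "(g has_vector_derivative f t (v t)) (at t)"
      using g(2)[OF T(2)] T(2) by (simp add: has_vector_derivative_def at_within_open[of t "{-T<..<T}"])
    ultimately show ?thesis
      using T(2) by (intro has_vector_derivative_transform_within_open[of g _ t "{-T<..<T}" v]) auto
  qed
  ultimately show ?thesis by (rule that)
qed

section \<open>Continuous dependence on parameters\<close>

text \<open>The second argument is made explicit, as it is differentiated in space as well.\<close>

definition time_derivative ::
  "(real \<Rightarrow> 'a::euclidean_space \<Rightarrow> 'b::real_normed_vector) \<Rightarrow> (real \<Rightarrow> 'a \<Rightarrow> 'b) \<Rightarrow> bool"
where
  "time_derivative u v \<longleftrightarrow>
     continuous_on UNIV (\<lambda>(t, x). u t x) \<and> continuous_on UNIV (\<lambda>(t, x). v t x) \<and>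
     (\<forall>t x. ((\<lambda>s. u s x) has_vector_derivative v t x) (at t))"

text \<open>For \<open>u\<close> in \<open>C^1(\<real>, C^n)\<close> every spatial derivative of \<open>u\<close> up to order \<open>n\<close> has as time derivative the
corresponding spatial derivative of \<open>v\<close>; this commutation is part of the recursion.\<close>

primrec evolving_family ::
  "nat \<Rightarrow> (real \<Rightarrow> 'a::euclidean_space \<Rightarrow> 'b::real_normed_vector) \<Rightarrow> (real \<Rightarrow> 'a \<Rightarrow> 'b) \<Rightarrow> bool"
where
  "evolving_family 0 u v = time_derivative u v"
| "evolving_family (Suc n) u v = (time_derivative u v \<and>
     (\<exists>u' v'. has_partials u u' \<and> has_partials v v' \<and>
        (\<forall>i\<in>Basis. evolving_family n (u' i) (v' i))))"

lemma evolving_family_time_derivative: "evolving_family n u v \<Longrightarrow> time_derivative u v"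
  by (cases n) auto

lemma evolving_family_imp_smooth:
  "evolving_family n u v \<Longrightarrow> smooth_family n u \<and> smooth_family n v"
proof (induction n arbitrary: u v)
  case (Suc n)
  then show ?case by (fastforce simp: time_derivative_def)
qed (auto simp: time_derivative_def)

text \<open>The bound is uniform in the parameter \<open>p\<close> and global in the state, and therefore passes to the
variational equations, which are linear in the state.\<close>

definition lipschitz_in_state ::
  "(real \<Rightarrow> 'p::euclidean_space \<times> 'e::euclidean_space \<Rightarrow> 'e) \<Rightarrow> bool"
where
  "lipschitz_in_state F \<longleftrightarrow> (\<forall>T. \<exists>L. \<forall>t p w w'. \<bar>t\<bar> \<le> T \<longrightarrow>
     norm (F t (p, w) - F t (p, w')) \<le> L * norm (w - w'))"

lemma lipschitz_in_stateE:
  assumes "lipschitz_in_state F"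
  obtains L where "0 \<le> L"
    and "\<And>t p w w'. \<bar>t\<bar> \<le> T \<Longrightarrow> norm (F t (p, w) - F t (p, w')) \<le> L * norm (w - w')"
proof -
  obtain L0 where L0: "\<And>t p w w'. \<bar>t\<bar> \<le> T \<Longrightarrow>
      norm (F t (p, w) - F t (p, w')) \<le> L0 * norm (w - w')"
    using assms unfolding lipschitz_in_state_def by blast
  have "norm (F t (p, w) - F t (p, w')) \<le> max L0 0 * norm (w - w')" if "\<bar>t\<bar> \<le> T" for t p w w'
    using L0[OF that] mult_right_mono[of L0 "max L0 0" "norm (w - w')"]
    by (meson max.cobounded1 norm_ge_zero order_trans)
  then show ?thesis using that[of "max L0 0"] by auto
qed

lemma norm_derivative_le_lipschitz:
  fixes f :: "'a::real_normed_vector \<Rightarrow> 'b::real_normed_vector"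
  assumes f': "(f has_derivative f') (at x)"
    and lip: "\<And>y. norm (f y - f x) \<le> L * norm (y - x)"
  shows "norm (f' h) \<le> L * norm h"
proof (cases "h = 0")
  case True
  then show ?thesis
    using has_derivative_bounded_linear[OF f'] by (simp add: linear_simps)
next
  case False
  interpret f': bounded_linear f' using f' by (rule has_derivative_bounded_linear)
  show ?thesis
  proof (rule field_le_epsilon)
    fix e :: real assume "0 < e"
    then have "0 < e / norm h" using False by simp
    then obtain d where "0 < d"
      and d: "\<And>y. norm (y - x) < d \<Longrightarrow> norm (f y - f x - f' (y - x)) \<le> e / norm h * norm (y - x)"
      using f' unfolding has_derivative_at_alt by blast
    define r where "r = d / (2 * norm h)"
    have r: "0 < r" "norm (r *\<^sub>R h) < d" using \<open>0 < d\<close> False by (auto simp: r_def)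
    have "norm (f (x + r *\<^sub>R h) - f x - f' (r *\<^sub>R h)) \<le> e / norm h * norm (r *\<^sub>R h)"
      using d[of "x + r *\<^sub>R h"] r by simp
    moreover have "norm (f (x + r *\<^sub>R h) - f x) \<le> L * norm (r *\<^sub>R h)"
      using lip[of "x + r *\<^sub>R h"] by simp
    moreover have "norm (f' (r *\<^sub>R h)) \<le>
        norm (f (x + r *\<^sub>R h) - f x) + norm (f (x + r *\<^sub>R h) - f x - f' (r *\<^sub>R h))"
      using norm_triangle_ineq4[of "f (x + r *\<^sub>R h) - f x" "f (x + r *\<^sub>R h) - f x - f' (r *\<^sub>R h)"]
      by simp
    ultimately have "norm (f' (r *\<^sub>R h)) \<le> L * norm (r *\<^sub>R h) + e / norm h * norm (r *\<^sub>R h)"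
      by linarith
    then have "r * norm (f' h) \<le> r * (L * norm h + e)"
      using r False by (simp add: f'.scaleR algebra_simps)
    then show "norm (f' h) \<le> L * norm h + e" using r by simp
  qed
qed

text \<open>For \<open>q\<close> near \<open>p0\<close> the curve \<open>U t q - U t p0\<close> satisfies Gronwall's inequality with the source
\<open>F t (q, U t p0) - F t (p0, U t p0)\<close>, which is uniformly small because \<open>U t p0\<close> runs through a compact
set as long as \<open>t\<close> is bounded.\<close>

lemma solution_continuous:
  fixes F :: "real \<Rightarrow> 'p::euclidean_space \<times> 'e::euclidean_space \<Rightarrow> 'e"
  assumes F: "continuous_on UNIV (\<lambda>(t, z). F t z)" and lip: "lipschitz_in_state F"
    and U': "\<And>t p. ((\<lambda>s. U s p) has_vector_derivative F t (p, U t p)) (at t)"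
    and U0: "continuous_on UNIV (U 0)"
  shows "continuous_on UNIV (\<lambda>(t, p). U t p)"
proof -
  have U_t: "continuous_on UNIV (\<lambda>t. U t p)" for p
    using U' by (meson continuous_at_imp_continuous_on has_vector_derivative_continuous)
  have "isCont (\<lambda>(t, p). U t p) (t0, p0)" for t0 p0
  proof -
    define T where "T = \<bar>t0\<bar> + 1"
    obtain L where "0 \<le> L"
      and L: "\<And>t p w w'. \<bar>t\<bar> \<le> T \<Longrightarrow> norm (F t (p, w) - F t (p, w')) \<le> L * norm (w - w')"
      using lipschitz_in_stateE[OF lip] by metis
    define K where "K = exp ((L + 1) * T)"
    have "0 < K" by (simp add: K_def)
    have "continuous_on UNIV (\<lambda>z. U (snd z) p0)"
      using continuous_on_compose2[OF U_t continuous_on_snd[OF continuous_on_id]] by simp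
    then have "continuous_on UNIV (\<lambda>z. (snd z, fst z, U (snd z) p0))"
      by (intro continuous_intros)
    then have cont_F: "continuous_on (UNIV \<times> {-T..T}) (\<lambda>z. case_prod F (snd z, fst z, U (snd z) p0))"
      using continuous_on_compose2[OF F] continuous_on_subset by blast
    show ?thesis
      unfolding continuous_at_eps_delta
    proof (intro allI impI)
      fix e :: real assume "0 < e"
      define \<epsilon> where "\<epsilon> = e / (4 * K)"
      have "0 < \<epsilon>" using \<open>0 < e\<close> \<open>0 < K\<close> by (simp add: \<epsilon>_def)
      obtain X where X: "p0 \<in> X" "open X"
        "\<forall>q\<in>X \<inter> UNIV. \<forall>t\<in>{-T..T}. dist (case_prod F (snd (q, t), fst (q, t), U (snd (q, t)) p0))
           (case_prod F (snd (p0, t), fst (p0, t), U (snd (p0, t)) p0)) \<le> \<epsilon>"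
        using continuous_on_prod_compactE[OF cont_F compact_Icc UNIV_I \<open>0 < \<epsilon>\<close>] by metis
      obtain d1 where "0 < d1" and d1: "\<And>q. dist q p0 < d1 \<Longrightarrow> q \<in> X"
        using X(1,2) by (metis open_dist)
      obtain d2 where "0 < d2" and d2: "\<And>q. dist q p0 < d2 \<Longrightarrow> dist (U 0 q) (U 0 p0) < \<epsilon>"
        using U0 \<open>0 < \<epsilon>\<close> unfolding continuous_on_iff by (metis UNIV_I)
      obtain d3 where "0 < d3" and d3: "\<And>t. dist t t0 < d3 \<Longrightarrow> dist (U t p0) (U t0 p0) < e / 2"
        using U_t[of p0] \<open>0 < e\<close> unfolding continuous_on_iff by (metis UNIV_I half_gt_zero)
      have close: "norm (U t q - U t p0) \<le> e / 2" if t: "\<bar>t\<bar> \<le> T" and q: "dist q p0 < min d1 d2" for t q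
      proof -
        have "norm (U t q - U t p0) \<le> K * (norm (U 0 q - U 0 p0) + \<epsilon>)"
          unfolding K_def
        proof (rule gronwall[OF _ _ t \<open>0 \<le> L\<close>])
          fix s assume s: "\<bar>s\<bar> \<le> T"
          show "((\<lambda>s. U s q - U s p0) has_vector_derivative F s (q, U s q) - F s (p0, U s p0)) (at s)"
            by (intro has_vector_derivative_diff U')
          have "q \<in> X" "s \<in> {-T..T}" using q s d1 by auto
          then have "norm (F s (q, U s p0) - F s (p0, U s p0)) \<le> \<epsilon>"
            using X(3) by (simp add: dist_norm)
          then show "norm (F s (q, U s q) - F s (p0, U s p0)) \<le> L * norm (U s q - U s p0) + \<epsilon>"
            using L[OF s, of q "U s q" "U s p0"]
              norm_triangle_ineq[of "F s (q, U s q) - F s (q, U s p0)" "F s (q, U s p0) - F s (p0, U s p0)"]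
            by simp
        qed (use \<open>0 < \<epsilon>\<close> in simp)
        also have "\<dots> \<le> K * (\<epsilon> + \<epsilon>)"
          using d2[of q] q \<open>0 < K\<close> by (intro mult_left_mono) (auto simp: dist_norm)
        also have "\<dots> = e / 2" using \<open>0 < K\<close> by (simp add: \<epsilon>_def)
        finally show ?thesis .
      qed
      have "dist (U t q) (U t0 p0) < e" if z: "dist (t, q) (t0, p0) < min (min d1 d2) (min d3 1)" for t q
      proof -
        have tq: "dist t t0 < min d3 1" "dist q p0 < min d1 d2"
          using dist_fst_le[of "(t, q)" "(t0, p0)"] dist_snd_le[of "(t, q)" "(t0, p0)"] z by auto
        then have "\<bar>t\<bar> \<le> T" by (auto simp: T_def dist_real_def)
        from close[OF this tq(2)] d3[of t] tq(1) show ?thesis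
          using dist_triangle[of "U t q" "U t0 p0" "U t p0"] by (simp add: dist_norm)
      qed
      then show "\<exists>d>0. \<forall>z. dist z (t0, p0) < d \<longrightarrow>
          dist (case z of (t, p) \<Rightarrow> U t p) (case (t0, p0) of (t, p) \<Rightarrow> U t p) < e"
        using \<open>0 < d1\<close> \<open>0 < d2\<close> \<open>0 < d3\<close>
        by (intro exI[of _ "min (min d1 d2) (min d3 1)"]) auto
    qed
  qed
  then show ?thesis by (auto simp: continuous_on_eq_continuous_at)
qed

lemma uniformly_close_on_compact_times:
  fixes u :: "real \<Rightarrow> 'a::metric_space \<Rightarrow> 'b::metric_space"
  assumes "continuous_on UNIV (\<lambda>(t, x). u t x)" and "0 < e"
  obtains d where "0 < d" "\<And>t x. \<bar>t\<bar> \<le> T \<Longrightarrow> dist x a < d \<Longrightarrow> dist (u t x) (u t a) \<le> e"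
proof -
  have "continuous_on (UNIV \<times> {-T..T}) (\<lambda>z :: 'a \<times> real. (snd z, fst z))"
    by (intro continuous_on_Pair continuous_on_snd continuous_on_fst continuous_on_id)
  from continuous_on_compose2[OF assms(1) this subset_UNIV]
  have cont: "continuous_on (UNIV \<times> {-T..T}) (\<lambda>z. case_prod u (snd z, fst z))" .
  obtain X where X: "a \<in> X" "open X"
    "\<forall>x\<in>X \<inter> UNIV. \<forall>t\<in>{-T..T}. dist (case_prod u (snd (x, t), fst (x, t)))
       (case_prod u (snd (a, t), fst (a, t))) \<le> e"
    using continuous_on_prod_compactE[OF cont compact_Icc UNIV_I \<open>0 < e\<close>] by metis
  obtain d where "0 < d" "\<And>x. dist x a < d \<Longrightarrow> x \<in> X"
    using X(1,2) by (metis open_dist)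
  with X(3) show ?thesis by (intro that[of d]) (auto simp: abs_le_iff)
qed

text \<open>The remainder of the first-order expansion is controlled by the oscillation of the partial
derivatives, via the mean value inequality. Around the points \<open>c t\<close> with \<open>\<bar>t\<bar> \<le> T\<close>, which form a compact
set, this oscillation is uniformly small.\<close>

lemma uniform_linearization:
  fixes F :: "real \<Rightarrow> 'a::euclidean_space \<Rightarrow> 'b::real_normed_vector"
  assumes F': "has_partials F F'"
    and cont: "\<And>i. i \<in> Basis \<Longrightarrow> continuous_on UNIV (\<lambda>(t, z). F' i t z)"
    and c: "continuous_on UNIV c" and "0 < e"
  shows "\<exists>d>0. \<forall>t \<zeta>. \<bar>t\<bar> \<le> T \<longrightarrow> norm \<zeta> < d \<longrightarrow>
      norm (F t (c t + \<zeta>) - F t (c t) - (\<Sum>i\<in>Basis. (\<zeta> \<bullet> i) *\<^sub>R F' i t (c t))) \<le> e * norm \<zeta>"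
proof -
  define k where "k t \<zeta> = (\<Sum>i\<in>Basis. norm (F' i t (c t + \<zeta>) - F' i t (c t)))" for t \<zeta>
  have c1: "continuous_on UNIV (\<lambda>z. c (fst z))"
    using continuous_on_compose2[OF c continuous_on_fst[OF continuous_on_id]] by simp
  have "continuous_on UNIV (\<lambda>z. (fst z, c (fst z) + snd z))"
    by (intro continuous_on_Pair continuous_on_add continuous_on_snd continuous_on_fst continuous_on_id c1)
  note 1 = continuous_on_compose2[OF cont this subset_UNIV]
  have "continuous_on UNIV (\<lambda>z. (fst z, c (fst z)))"
    by (intro continuous_on_Pair continuous_on_fst continuous_on_id c1)
  note 2 = continuous_on_compose2[OF cont this subset_UNIV]
  have "continuous_on UNIV (\<lambda>z. norm (F' i (fst z) (c (fst z) + snd z) - F' i (fst z) (c (fst z))))"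
    if "i \<in> Basis" for i
    using continuous_on_norm[OF continuous_on_diff[OF 1[OF that] 2[OF that]]] by simp
  then have "continuous_on UNIV (\<lambda>(t, \<zeta>). k t \<zeta>)"
    unfolding k_def case_prod_beta by (intro continuous_on_sum) auto
  from uniformly_close_on_compact_times[OF this \<open>0 < e\<close>, of T 0]
  obtain d where "0 < d" and d: "\<And>t \<zeta>. \<bar>t\<bar> \<le> T \<Longrightarrow> norm \<zeta> < d \<Longrightarrow> dist (k t \<zeta>) (k t 0) \<le> e"
    by (auto simp: dist_norm)
  have "norm (F t (c t + \<zeta>) - F t (c t) - (\<Sum>i\<in>Basis. (\<zeta> \<bullet> i) *\<^sub>R F' i t (c t))) \<le> e * norm \<zeta>"
    if t: "\<bar>t\<bar> \<le> T" and \<zeta>: "norm \<zeta> < d" for t \<zeta>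
  proof -
    define \<Phi> where "\<Phi> \<xi> = F t (c t + \<xi>) - (\<Sum>i\<in>Basis. (\<xi> \<bullet> i) *\<^sub>R F' i t (c t))" for \<xi>
    have lin: "bounded_linear (\<lambda>\<xi>. \<Sum>i\<in>Basis. (\<xi> \<bullet> i) *\<^sub>R F' i t (c t))"
      by (intro bounded_linear_sum bounded_linear_scaleR_left bounded_linear_compose[OF bounded_linear_scaleR_left]
          bounded_linear_inner_left)
    have "norm (\<Phi> \<zeta> - \<Phi> 0) \<le> e * norm (\<zeta> - 0)"
    proof (rule differentiable_bound[where S = "ball 0 d"])
      fix \<xi> :: 'a assume \<xi>: "\<xi> \<in> ball 0 d"
      have "((\<lambda>\<xi>. F t (c t + \<xi>)) has_derivative (\<lambda>h. \<Sum>i\<in>Basis. (h \<bullet> i) *\<^sub>R F' i t (c t + \<xi>))) (at \<xi>)"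
        by (rule has_derivative_compose[OF _ has_partialsD[OF F']]) (auto intro!: derivative_eq_intros)
      from has_derivative_diff[OF this bounded_linear_imp_has_derivative[OF lin]]
      have "(\<Phi> has_derivative (\<lambda>h. \<Sum>i\<in>Basis. (h \<bullet> i) *\<^sub>R (F' i t (c t + \<xi>) - F' i t (c t)))) (at \<xi>)"
        unfolding \<Phi>_def by (simp add: sum_subtractf scaleR_diff_right)
      then show "(\<Phi> has_derivative (\<lambda>h. \<Sum>i\<in>Basis. (h \<bullet> i) *\<^sub>R (F' i t (c t + \<xi>) - F' i t (c t))))
          (at \<xi> within ball 0 d)"
        by (rule has_derivative_at_withinI)
      show "onorm (\<lambda>h. \<Sum>i\<in>Basis. (h \<bullet> i) *\<^sub>R (F' i t (c t + \<xi>) - F' i t (c t))) \<le> e"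
      proof (rule onorm_le)
        fix h :: 'a
        have "norm (\<Sum>i\<in>Basis. (h \<bullet> i) *\<^sub>R (F' i t (c t + \<xi>) - F' i t (c t))) \<le>
            (\<Sum>i\<in>Basis. norm h * norm (F' i t (c t + \<xi>) - F' i t (c t)))"
          by (rule sum_norm_le) (auto intro!: mult_right_mono Basis_le_norm)
        also have "\<dots> = norm h * k t \<xi>" by (simp add: k_def sum_distrib_left)
        also have "\<dots> \<le> norm h * e"
          using d[OF t, of \<xi>] \<xi> by (intro mult_left_mono) (auto simp: k_def dist_real_def)
        finally show "norm (\<Sum>i\<in>Basis. (h \<bullet> i) *\<^sub>R (F' i t (c t + \<xi>) - F' i t (c t))) \<le> e * norm h"
          by (simp only: mult.commute[of e])
      qed
    qed (use \<zeta> \<open>0 < d\<close> in auto)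
    then show ?thesis by (simp add: \<Phi>_def algebra_simps)
  qed
  with \<open>0 < d\<close> show ?thesis by (intro exI[of _ d]) simp
qed

section \<open>Smooth dependence on parameters\<close>

text \<open>The linear map with the values \<open>D\<close> on the basis; with partial derivatives for \<open>D\<close>, the total
derivative.\<close>

definition partials_sum :: "('a::euclidean_space \<Rightarrow> 'b::real_normed_vector) \<Rightarrow> 'a \<Rightarrow> 'b" where
  "partials_sum D h = (\<Sum>j\<in>Basis. (h \<bullet> j) *\<^sub>R D j)"

lemma bounded_linear_partials_sum: "bounded_linear (partials_sum D)"
  unfolding partials_sum_def
  by (intro bounded_linear_sum bounded_linear_compose[OF bounded_linear_scaleR_left]
      bounded_linear_inner_left)

text \<open>The directional derivatives of \<open>p \<mapsto> F t (p, U t p)\<close>: if \<open>w i\<close> are the partial derivatives of \<open>U t\<close>, the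
left-hand side is the chain rule, and the summands on the right are its partial derivatives.\<close>

lemma partials_sum_Pair_sum:
  fixes h :: "'p::euclidean_space" and w :: "'p \<Rightarrow> 'e::euclidean_space"
  shows "partials_sum D (h, \<Sum>i\<in>Basis. (h \<bullet> i) *\<^sub>R w i) =
    (\<Sum>i\<in>Basis. (h \<bullet> i) *\<^sub>R partials_sum D (i, w i))"
proof -
  interpret bounded_linear "partials_sum D" by (rule bounded_linear_partials_sum)
  have "(h, \<Sum>i\<in>Basis. (h \<bullet> i) *\<^sub>R w i) = (\<Sum>i\<in>Basis. (h \<bullet> i) *\<^sub>R (i, w i))"
    by (rule prod_eqI) (simp_all add: fst_sum snd_sum euclidean_representation)
  then show ?thesis by (simp only: sum scaleR)
qed

lemma norm_partials_sum_state_le: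
  fixes F :: "real \<Rightarrow> 'p::euclidean_space \<times> 'e::euclidean_space \<Rightarrow> 'e"
  assumes F': "has_partials F F'"
    and L: "\<And>w'. norm (F t (p, w') - F t (p, w)) \<le> L * norm (w' - w)"
  shows "norm (partials_sum (\<lambda>j. F' j t (p, w)) (0, h)) \<le> L * norm h"
proof -
  have "((\<lambda>w'. (p, w')) has_derivative (\<lambda>h. (0, h))) (at w)"
    by (auto intro!: derivative_eq_intros)
  from has_derivative_compose[OF this has_partialsD[OF F', of t "(p, w)"]]
  show ?thesis
    unfolding partials_sum_def by (rule norm_derivative_le_lipschitz) (rule L)
qed

text \<open>The candidates \<open>W i\<close> for the partial derivatives solve the variational equation. The error
\<open>R\<close> of the linear approximation has a derivative bounded by a multiple of \<open>\<bar>R\<bar>\<close> plus a source of size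
\<open>o(\<bar>q - p\<bar>)\<close>, and Gronwall's inequality turns this into \<open>R = o(\<bar>q - p\<bar>)\<close>. The increment of \<open>U\<close> that occurs
in the source is itself estimated by \<open>\<bar>R\<bar> + C \<bar>q - p\<bar>\<close>, which closes the
inequality.\<close>

lemma solution_has_partials:
  fixes F :: "real \<Rightarrow> 'p::euclidean_space \<times> 'e::euclidean_space \<Rightarrow> 'e"
  assumes F': "has_partials F F'"
    and F'_cont: "\<And>j. j \<in> Basis \<Longrightarrow> continuous_on UNIV (\<lambda>(t, z). F' j t z)"
    and lip: "lipschitz_in_state F"
    and U': "\<And>t p. ((\<lambda>s. U s p) has_vector_derivative F t (p, U t p)) (at t)"
    and U_cont: "continuous_on UNIV (\<lambda>(t, p). U t p)"
    and U0: "\<And>p. (U 0 has_derivative (\<lambda>h. \<Sum>i\<in>Basis. (h \<bullet> i) *\<^sub>R W i 0 p)) (at p)"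
    and W': "\<And>i t p. ((\<lambda>s. W i s p) has_vector_derivative
      partials_sum (\<lambda>j. F' j t (p, U t p)) (i, W i t p)) (at t)"
  shows "has_partials U W"
  unfolding has_partials_def
proof (intro allI)
  fix t :: real and p :: 'p
  define T where "T = \<bar>t\<bar>"
  obtain L where "0 \<le> L"
    and L: "\<And>s p w w'. \<bar>s\<bar> \<le> T \<Longrightarrow> norm (F s (p, w) - F s (p, w')) \<le> L * norm (w - w')"
    using lipschitz_in_stateE[OF lip] by metis
  have "continuous_on UNIV (\<lambda>s. W i s p)" for i
    using W' by (meson continuous_at_imp_continuous_on has_vector_derivative_continuous)
  then have "continuous_on {-T..T} (\<lambda>s. \<Sum>i\<in>Basis. norm (W i s p))"
    by (intro continuous_on_sum continuous_on_norm) (auto intro: continuous_on_subset)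
  then have "bounded ((\<lambda>s. \<Sum>i\<in>Basis. norm (W i s p)) ` {-T..T})"
    by (intro compact_imp_bounded compact_continuous_image compact_Icc)
  then obtain C where "\<forall>y\<in>(\<lambda>s. \<Sum>i\<in>Basis. norm (W i s p)) ` {-T..T}. norm y \<le> C"
    unfolding bounded_iff by blast
  then have C: "(\<Sum>i\<in>Basis. norm (W i s p)) \<le> C" if "\<bar>s\<bar> \<le> T" for s
    using that by (force simp: abs_le_iff)
  have "0 \<le> C" using C[of 0] sum_nonneg[of Basis "\<lambda>i. norm (W i 0 p)"] by (simp add: T_def)
  define K where "K = exp ((L + 1 + 1) * T)"
  have "0 < K" by (simp add: K_def)
  have lin: "bounded_linear (\<lambda>h. \<Sum>i\<in>Basis. (h \<bullet> i) *\<^sub>R W i s p)" for s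
    using bounded_linear_partials_sum[of "\<lambda>i. W i s p"] unfolding partials_sum_def .
  have "continuous_on UNIV (\<lambda>s. U s p)"
    using U' by (meson continuous_at_imp_continuous_on has_vector_derivative_continuous)
  then have c: "continuous_on UNIV (\<lambda>s. (p, U s p))"
    by (intro continuous_on_Pair continuous_on_const)
  have "\<exists>d>0. \<forall>q. norm (q - p) < d \<longrightarrow>
      norm (U t q - U t p - (\<Sum>i\<in>Basis. ((q - p) \<bullet> i) *\<^sub>R W i t p)) \<le> e * norm (q - p)"
    if "0 < e" for e
  proof -
    \<comment> \<open>Gronwall's inequality yields \<open>K (\<epsilon> + \<epsilon> (1 + C)) \<bar>q - p\<bar>\<close>; the bound 1 lets \<open>\<epsilon> \<bar>R\<bar>\<close> be absorbed into
      the growth rate \<open>L + 1\<close>.\<close>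
    define \<epsilon> where "\<epsilon> = min 1 (e / (K * (2 + C)))"
    have \<epsilon>: "0 < \<epsilon>" "\<epsilon> \<le> 1" "K * (\<epsilon> * (2 + C)) \<le> e"
    proof -
      show "0 < \<epsilon>" "\<epsilon> \<le> 1" using \<open>0 < e\<close> \<open>0 < K\<close> \<open>0 \<le> C\<close> by (auto simp: \<epsilon>_def)
      have "\<epsilon> * (K * (2 + C)) \<le> e / (K * (2 + C)) * (K * (2 + C))"
        using \<open>0 < K\<close> \<open>0 \<le> C\<close> by (intro mult_right_mono) (auto simp: \<epsilon>_def)
      then show "K * (\<epsilon> * (2 + C)) \<le> e"
        using \<open>0 < K\<close> \<open>0 \<le> C\<close> by (simp add: mult_ac)
    qed
    obtain d1 where "0 < d1" and d1: "\<forall>s \<zeta>. \<bar>s\<bar> \<le> T \<longrightarrow> norm \<zeta> < d1 \<longrightarrow>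
        norm (F s ((p, U s p) + \<zeta>) - F s (p, U s p) -
          (\<Sum>j\<in>Basis. (\<zeta> \<bullet> j) *\<^sub>R F' j s (p, U s p))) \<le> \<epsilon> * norm \<zeta>"
      using uniform_linearization[OF F' F'_cont c \<epsilon>(1), of T] by blast
    obtain d2 where "0 < d2"
      and d2: "\<And>s q. \<bar>s\<bar> \<le> T \<Longrightarrow> dist q p < d2 \<Longrightarrow> dist (U s q) (U s p) \<le> d1 / 4"
      using uniformly_close_on_compact_times[OF U_cont, of "d1 / 4" T p] \<open>0 < d1\<close> by (metis zero_less_divide_iff zero_less_numeral)
    obtain d3 where "0 < d3" and d3: "\<And>q. norm (q - p) < d3 \<Longrightarrow>
        norm (U 0 q - U 0 p - (\<Sum>i\<in>Basis. ((q - p) \<bullet> i) *\<^sub>R W i 0 p)) \<le> \<epsilon> * norm (q - p)"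
      using U0[of p] \<epsilon>(1) unfolding has_derivative_at_alt by blast
    have "norm (U t q - U t p - (\<Sum>i\<in>Basis. ((q - p) \<bullet> i) *\<^sub>R W i t p)) \<le> e * norm (q - p)"
      if q: "norm (q - p) < min (d1 / 2) (min d2 d3)" for q
    proof -
      define h where "h = q - p"
      define R where "R s = U s q - U s p - (\<Sum>i\<in>Basis. (h \<bullet> i) *\<^sub>R W i s p)" for s
      define R' where "R' s = F s (q, U s q) - F s (p, U s p) -
        (\<Sum>i\<in>Basis. (h \<bullet> i) *\<^sub>R partials_sum (\<lambda>j. F' j s (p, U s p)) (i, W i s p))" for s
      have "norm (R t) \<le> exp ((L + 1 + 1) * T) * (norm (R 0) + \<epsilon> * (1 + C) * norm h)"
      proof (rule gronwall)
        fix s assume s: "\<bar>s\<bar> \<le> T"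
        show "(R has_vector_derivative R' s) (at s)"
          unfolding R_def R'_def
          by (intro has_vector_derivative_diff has_vector_derivative_sum U'
              bounded_linear.has_vector_derivative[OF bounded_linear_scaleR_right W'])
        define \<Delta> where "\<Delta> = U s q - U s p"
        interpret D: bounded_linear "partials_sum (\<lambda>j. F' j s (p, U s p))"
          by (rule bounded_linear_partials_sum)
        have "norm \<Delta> \<le> d1 / 4"
          using d2[OF s, of q] q by (simp add: dist_norm \<Delta>_def)
        moreover have norm_pair: "norm (h, \<Delta>) \<le> norm h + norm \<Delta>"
          by (rule norm_Pair_le)
        ultimately have "norm (h, \<Delta>) < d1"
          using q \<open>0 < d1\<close> by (simp add: h_def)
        then have lin_F: "norm (F s (q, U s q) - F s (p, U s p) -
            partials_sum (\<lambda>j. F' j s (p, U s p)) (h, \<Delta>)) \<le> \<epsilon> * norm (h, \<Delta>)"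
          using d1[rule_format, OF s, of "(h, \<Delta>)"] by (simp add: partials_sum_def h_def \<Delta>_def)
        have "partials_sum (\<lambda>j. F' j s (p, U s p)) (0, R s) =
            partials_sum (\<lambda>j. F' j s (p, U s p)) (h, \<Delta>) -
            partials_sum (\<lambda>j. F' j s (p, U s p)) (h, \<Sum>i\<in>Basis. (h \<bullet> i) *\<^sub>R W i s p)"
          unfolding D.diff[symmetric] by (simp add: R_def \<Delta>_def)
        then have R'_eq: "R' s = (F s (q, U s q) - F s (p, U s p) -
            partials_sum (\<lambda>j. F' j s (p, U s p)) (h, \<Delta>)) +
            partials_sum (\<lambda>j. F' j s (p, U s p)) (0, R s)"
          by (simp add: R'_def partials_sum_Pair_sum[symmetric])
        have "norm (\<Sum>i\<in>Basis. (h \<bullet> i) *\<^sub>R W i s p) \<le> (\<Sum>i\<in>Basis. norm h * norm (W i s p))"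
          by (rule sum_norm_le) (auto intro!: mult_right_mono Basis_le_norm)
        also have "\<dots> \<le> norm h * C"
          using C[OF s] by (simp add: sum_distrib_left[symmetric] mult_left_mono)
        finally have "norm \<Delta> \<le> norm (R s) + norm h * C"
          using norm_triangle_ineq[of "R s" "\<Sum>i\<in>Basis. (h \<bullet> i) *\<^sub>R W i s p"]
          by (simp add: R_def \<Delta>_def)
        then have "norm (h, \<Delta>) \<le> norm h + (norm (R s) + norm h * C)"
          using norm_pair by linarith
        then have "\<epsilon> * norm (h, \<Delta>) \<le> \<epsilon> * (norm h + (norm (R s) + norm h * C))"
          using \<epsilon> by (intro mult_left_mono) auto
        also have "\<dots> = \<epsilon> * norm (R s) + \<epsilon> * (1 + C) * norm h"
          by (simp add: algebra_simps)
        also have "\<dots> \<le> 1 * norm (R s) + \<epsilon> * (1 + C) * norm h"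
          using \<epsilon> by (intro add_right_mono mult_right_mono) auto
        finally have "\<epsilon> * norm (h, \<Delta>) \<le> norm (R s) + \<epsilon> * (1 + C) * norm h" by simp
        moreover have "norm (partials_sum (\<lambda>j. F' j s (p, U s p)) (0, R s)) \<le> L * norm (R s)"
          by (rule norm_partials_sum_state_le[OF F' L[OF s]])
        ultimately show "norm (R' s) \<le> (L + 1) * norm (R s) + \<epsilon> * (1 + C) * norm h"
          using lin_F norm_triangle_ineq[of "F s (q, U s q) - F s (p, U s p) -
            partials_sum (\<lambda>j. F' j s (p, U s p)) (h, \<Delta>)"
            "partials_sum (\<lambda>j. F' j s (p, U s p)) (0, R s)"]
          unfolding R'_eq by (simp add: algebra_simps)
      qed (use \<epsilon> \<open>0 \<le> L\<close> \<open>0 \<le> C\<close> in \<open>auto simp: T_def\<close>)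
      also have "\<dots> \<le> K * (\<epsilon> * norm h + \<epsilon> * (1 + C) * norm h)"
        using d3[of q] q by (simp add: K_def R_def h_def)
      also have "\<dots> = K * (\<epsilon> * (2 + C)) * norm h" by (simp add: algebra_simps)
      also have "\<dots> \<le> e * norm h" using \<epsilon>(3) by (intro mult_right_mono) auto
      finally show ?thesis by (simp add: R_def h_def)
    qed
    then show ?thesis
      using \<open>0 < d1\<close> \<open>0 < d2\<close> \<open>0 < d3\<close> by (intro exI[of _ "min (d1 / 2) (min d2 d3)"]) auto
  qed
  with lin show "(U t has_derivative (\<lambda>h. \<Sum>i\<in>Basis. (h \<bullet> i) *\<^sub>R W i t p)) (at p)"
    unfolding has_derivative_at_alt by blast
qed

lemma smooth_family_freeze: "smooth_family n u \<Longrightarrow> smooth_family n (\<lambda>_. u t0)"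
proof (induction n arbitrary: u)
  case 0
  have "continuous_on UNIV (\<lambda>z :: real \<times> 'a. (t0, snd z))"
    by (intro continuous_on_Pair continuous_on_const continuous_on_snd continuous_on_id)
  from continuous_on_compose2[OF smooth_family_continuous[OF 0] this subset_UNIV]
  show ?case by (simp add: case_prod_beta)
next
  case (Suc n)
  obtain u' where u': "continuous_on UNIV (\<lambda>(t, x). u t x)" "has_partials u u'"
    "\<And>i. i \<in> Basis \<Longrightarrow> smooth_family n (u' i)"
    using smooth_family_Suc_partials[OF Suc.prems] by blast
  have "continuous_on UNIV (\<lambda>z :: real \<times> 'a. (t0, snd z))"
    by (intro continuous_on_Pair continuous_on_const continuous_on_snd continuous_on_id)
  from continuous_on_compose2[OF u'(1) this subset_UNIV]
  have "continuous_on UNIV (\<lambda>(t :: real, x). u t0 x)" by (simp add: case_prod_beta)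
  then show ?case
    by (rule smooth_family_SucI[where u' = "\<lambda>i _. u' i t0"])
      (use u' Suc.IH in \<open>auto simp: has_partials_def\<close>)
qed

lemma smooth_family_along_solution:
  fixes F :: "real \<Rightarrow> 'p::euclidean_space \<times> 'e::euclidean_space \<Rightarrow> 'b::real_normed_vector"
  assumes "smooth_family n F" "smooth_family n U"
  shows "smooth_family n (\<lambda>t p. F t (p, U t p))"
  using smooth_family_compose[OF assms(1)
      smooth_family_Pair[OF smooth_family_linear[OF bounded_linear_ident] assms(2)]] .

text \<open>In the step from \<open>n\<close> to \<open>n + 1\<close> the induction hypothesis is used twice: for \<open>U\<close> itself, to see that the
coefficients of the variational equation are of order \<open>n\<close>, and then for the solutions of the
variational equation, which are the partial derivatives of \<open>U\<close>. The right-hand side of the variational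
equation is at the same time the partial derivative of the right-hand side of the original
equation along the solution; hence the derivatives in time and in the parameter commute.\<close>

theorem solution_evolving_family:
  fixes F :: "real \<Rightarrow> 'p::euclidean_space \<times> 'e::euclidean_space \<Rightarrow> 'e"
  assumes "smooth_family n F" and "lipschitz_in_state F"
    and "\<And>t p. ((\<lambda>s. U s p) has_vector_derivative F t (p, U t p)) (at t)"
    and "smooth_family n (\<lambda>_. U 0)"
  shows "evolving_family n U (\<lambda>t p. F t (p, U t p))"
  using assms
proof (induction n arbitrary: F U)
  case (0 F U)
  have "continuous_on UNIV (\<lambda>z :: 'p. (0 :: real, z))"
    by (intro continuous_on_Pair continuous_on_const continuous_on_id)
  from continuous_on_compose2[OF smooth_family_continuous[OF 0(4)] this subset_UNIV]
  have U0: "continuous_on UNIV (U 0)" by simp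
  have "smooth_family 0 U"
    using solution_continuous[OF smooth_family_continuous[OF 0(1)] 0(2,3) U0] by simp
  then show ?case
    using smooth_family_along_solution[OF 0(1)] 0(3) by (simp add: time_derivative_def)
next
  case (Suc n F U)
  have IH: "evolving_family n U (\<lambda>t p. F t (p, U t p))"
    by (rule Suc.IH[OF smooth_family_SucD[OF Suc.prems(1)] Suc.prems(2,3)
          smooth_family_SucD[OF Suc.prems(4)]])
  then have U_smooth: "smooth_family n U" and U_time: "time_derivative U (\<lambda>t p. F t (p, U t p))"
    using evolving_family_imp_smooth evolving_family_time_derivative by blast+
  obtain F' where F': "has_partials F F'" "\<And>j. j \<in> Basis \<Longrightarrow> smooth_family n (F' j)"
    using smooth_family_Suc_partials[OF Suc.prems(1)] by blast
  obtain G where G: "has_partials (\<lambda>_. U 0) G" "\<And>i. i \<in> Basis \<Longrightarrow> smooth_family n (G i)"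
    using smooth_family_Suc_partials[OF Suc.prems(4)] by blast
  \<comment> \<open>The variational equation in direction \<open>i\<close>; the solution \<open>U\<close> enters as a function of the parameter.\<close>
  define A where "A i t z = partials_sum (\<lambda>j. F' j t (fst z, U t (fst z))) (i, snd z)"
    for i :: 'p and t and z :: "'p \<times> 'e"
  have A_smooth: "smooth_family n (A i)" for i
  proof -
    have U1: "smooth_family n (\<lambda>t z. U t (fst z))"
      by (rule smooth_family_compose[OF U_smooth smooth_family_linear[OF bounded_linear_fst]])
    have "smooth_family n (\<lambda>t z. F' j t (fst z, U t (fst z)))" if "j \<in> Basis" for j
      by (rule smooth_family_compose[OF F'(2)[OF that]
            smooth_family_Pair[OF smooth_family_linear[OF bounded_linear_fst] U1]])
    moreover have "smooth_family n (\<lambda>t z. (i, snd z) \<bullet> j)" for j :: "'p \<times> 'e"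
      by (rule smooth_family_bounded_linear[OF bounded_linear_inner_left
            smooth_family_Pair[OF smooth_family_const smooth_family_linear[OF bounded_linear_snd]]])
    ultimately have "smooth_family n (\<lambda>t z. \<Sum>j\<in>Basis. ((i, snd z) \<bullet> j) *\<^sub>R F' j t (fst z, U t (fst z)))"
      by (intro smooth_family_sum smooth_family_scaleR)
    then show ?thesis unfolding A_def partials_sum_def .
  qed
  have A_lip: "\<exists>L. \<forall>t p w w'. \<bar>t\<bar> \<le> T \<longrightarrow> norm (A i t (p, w) - A i t (p, w')) \<le> L * norm (w - w')" for i T
  proof -
    obtain L where L: "\<And>t p w w'. \<bar>t\<bar> \<le> T \<Longrightarrow> norm (F t (p, w) - F t (p, w')) \<le> L * norm (w - w')"
      using lipschitz_in_stateE[OF Suc.prems(2)] by metis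
    have "norm (A i t (p, w) - A i t (p, w')) \<le> L * norm (w - w')" if "\<bar>t\<bar> \<le> T" for t p w w'
    proof -
      interpret bounded_linear "partials_sum (\<lambda>j. F' j t (p, U t p))"
        by (rule bounded_linear_partials_sum)
      have "A i t (p, w) - A i t (p, w') = partials_sum (\<lambda>j. F' j t (p, U t p)) (0, w - w')"
        unfolding A_def fst_conv snd_conv diff[symmetric] by simp
      then show ?thesis using norm_partials_sum_state_le[OF F'(1) L[OF that]] by simp
    qed
    then show ?thesis by blast
  qed
  have "\<exists>w. w 0 = G i 0 p \<and> (\<forall>t. (w has_vector_derivative A i t (p, w t)) (at t))" for i p
  proof -
    have "continuous_on UNIV (\<lambda>z :: real \<times> 'e. (fst z, (p, snd z)))"
      by (intro continuous_on_Pair continuous_on_const continuous_on_fst continuous_on_snd continuous_on_id)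
    from continuous_on_compose2[OF smooth_family_continuous[OF A_smooth] this subset_UNIV]
    have "continuous_on UNIV (\<lambda>(t, w). A i t (p, w))" by (simp add: case_prod_beta)
    moreover have "\<exists>L. \<forall>t w w'. \<bar>t\<bar> \<le> T \<longrightarrow> norm (A i t (p, w) - A i t (p, w')) \<le> L * norm (w - w')" for T
      using A_lip by metis
    ultimately show ?thesis using global_ode_solution[of "\<lambda>t w. A i t (p, w)" "G i 0 p"] by metis
  qed
  then obtain w where w: "\<And>i p. w i p 0 = G i 0 p"
    "\<And>i p t. (w i p has_vector_derivative A i t (p, w i p t)) (at t)" by metis
  define W where "W i t p = w i p t" for i t p
  have W0: "W i 0 = G i 0" for i by (simp add: W_def w fun_eq_iff)
  have W': "((\<lambda>s. W i s p) has_vector_derivative A i t (p, W i t p)) (at t)" for i t p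
    unfolding W_def by (rule w)
  have W_evolving: "evolving_family n (W i) (\<lambda>t p. A i t (p, W i t p))" if "i \<in> Basis" for i
  proof (rule Suc.IH[OF A_smooth _ W'])
    show "lipschitz_in_state (A i)" unfolding lipschitz_in_state_def using A_lip by blast
    show "smooth_family n (\<lambda>_. W i 0)" unfolding W0 by (rule smooth_family_freeze[OF G(2)[OF that]])
  qed
  have U_partials: "has_partials U W"
  proof (rule solution_has_partials[OF F'(1) smooth_family_continuous[OF F'(2)] Suc.prems(2,3)
        smooth_family_continuous[OF U_smooth]])
    show "(U 0 has_derivative (\<lambda>h. \<Sum>i\<in>Basis. (h \<bullet> i) *\<^sub>R W i 0 p)) (at p)" for p
      using has_partialsD[OF G(1)] by (simp add: W0)
    show "((\<lambda>s. W i s p) has_vector_derivative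
        partials_sum (\<lambda>j. F' j t (p, U t p)) (i, W i t p)) (at t)" for i t p
      using W'[of i p t] by (simp add: A_def)
  qed
  have "has_partials (\<lambda>t p. F t (p, U t p)) (\<lambda>i t p. A i t (p, W i t p))"
    unfolding has_partials_def
  proof (intro allI)
    fix t p
    have "((\<lambda>p. (p, U t p)) has_derivative (\<lambda>h. (h, \<Sum>i\<in>Basis. (h \<bullet> i) *\<^sub>R W i t p))) (at p)"
      by (intro has_derivative_Pair has_derivative_ident has_partialsD[OF U_partials])
    from has_derivative_compose[OF this has_partialsD[OF F'(1)]]
    show "((\<lambda>p. F t (p, U t p)) has_derivative (\<lambda>h. \<Sum>i\<in>Basis. (h \<bullet> i) *\<^sub>R A i t (p, W i t p))) (at p)"
      by (simp add: A_def partials_sum_Pair_sum[symmetric]) (simp add: partials_sum_def)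
  qed
  then show ?case using U_time U_partials W_evolving by auto
qed

section \<open>Iterated derivatives and \<open>C^1\<close> dependence on time\<close>

lemma continuous_family_uniform_limit:
  fixes w :: "real \<Rightarrow> 'a::metric_space \<Rightarrow> 'b::metric_space"
  assumes w: "continuous_on UNIV (\<lambda>(t, x). w t x)" and "compact S"
  shows "uniform_limit S w (w t) (at t)"
proof (rule uniform_limitI)
  fix e :: real assume "0 < e"
  then have "0 < e / 2" by simp
  have cont: "continuous_on (UNIV \<times> S) (\<lambda>(t, x). w t x)"
    using w by (rule continuous_on_subset) simp
  obtain X where X: "t \<in> X" "open X"
    "\<forall>s\<in>X \<inter> UNIV. \<forall>x\<in>S. dist ((\<lambda>(t, x). w t x) (s, x)) ((\<lambda>(t, x). w t x) (t, x)) \<le> e / 2"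
    using continuous_on_prod_compactE[OF cont \<open>compact S\<close> UNIV_I \<open>0 < e / 2\<close>] by metis
  have "\<forall>\<^sub>F s in at t. s \<in> X"
    using X(1,2) eventually_at_topological by blast
  then show "\<forall>\<^sub>F s in at t. \<forall>x\<in>S. dist (w s x) (w t x) < e"
    using X(3) \<open>0 < e\<close> by (auto elim!: eventually_mono intro: le_less_trans[of _ "e / 2"])
qed

text \<open>Every point has a compact neighbourhood, so that uniform limits on compact sets in one variable
and continuity in the other combine to joint continuity.\<close>

lemma continuous_family_of_uniform_limits:
  fixes w :: "real \<Rightarrow> 'a::heine_borel \<Rightarrow> 'b::metric_space"
  assumes cont: "\<And>t. continuous_on UNIV (w t)"
    and lim: "\<And>t S. compact S \<Longrightarrow> uniform_limit S w (w t) (at t)"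
  shows "continuous_on UNIV (\<lambda>(t, x). w t x)"
proof -
  have "isCont (\<lambda>(t, x). w t x) (t0, x0)" for t0 x0
    unfolding continuous_at_eps_delta
  proof (intro allI impI)
    fix e :: real assume "0 < e"
    then have "\<forall>\<^sub>F s in at t0. \<forall>x\<in>cball x0 1. dist (w s x) (w t0 x) < e / 2"
      by (intro uniform_limitD[OF lim]) auto
    then obtain d1 where "0 < d1" and d1: "\<And>s x. s \<noteq> t0 \<Longrightarrow> dist s t0 < d1 \<Longrightarrow>
        x \<in> cball x0 1 \<Longrightarrow> dist (w s x) (w t0 x) < e / 2"
      unfolding eventually_at by blast
    obtain d2 where "0 < d2" and d2: "\<And>x. dist x x0 < d2 \<Longrightarrow> dist (w t0 x) (w t0 x0) < e / 2"
      using cont[of t0] \<open>0 < e\<close> unfolding continuous_on_iff by (metis UNIV_I half_gt_zero)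
    have "dist (w s x) (w t0 x0) < e" if z: "dist (s, x) (t0, x0) < min d1 (min d2 1)" for s x
    proof -
      have sx: "dist s t0 < d1" "dist x x0 < min d2 1"
        using dist_fst_le[of "(s, x)" "(t0, x0)"] dist_snd_le[of "(s, x)" "(t0, x0)"] z by auto
      have "dist (w s x) (w t0 x) < e / 2"
        using d1[of s x] sx \<open>0 < e\<close> by (cases "s = t0") (auto simp: dist_commute)
      moreover have "dist (w t0 x) (w t0 x0) < e / 2" using d2 sx by auto
      ultimately show ?thesis using dist_triangle[of "w s x" "w t0 x0" "w t0 x"] by linarith
    qed
    then show "\<exists>d>0. \<forall>z. dist z (t0, x0) < d \<longrightarrow>
        dist (case z of (t, x) \<Rightarrow> w t x) (case (t0, x0) of (t, x) \<Rightarrow> w t x) < e"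
      using \<open>0 < d1\<close> \<open>0 < d2\<close> by (intro exI[of _ "min d1 (min d2 1)"]) auto
  qed
  then show ?thesis by (auto simp: continuous_on_eq_continuous_at)
qed

lemma C0_C_k_imp_smooth_family:
  assumes u: "C0_C_k n u"
  shows "smooth_family n u"
proof -
  have cont: "continuous_on UNIV (\<lambda>(t, x). iter_deriv vs (u t) x)"
    if "set vs \<subseteq> Basis" "length vs \<le> n" for vs
  proof (rule continuous_family_of_uniform_limits)
    show "continuous_on UNIV (iter_deriv vs (u t))" for t
      using u that unfolding C0_C_k_def C_k_def by blast
    show "uniform_limit S (\<lambda>t. iter_deriv vs (u t)) (iter_deriv vs (u t)) (at t)"
      if "compact S" for t S
      using u that \<open>set vs \<subseteq> Basis\<close> \<open>length vs \<le> n\<close> unfolding C0_C_k_def C_k_tendsto_def by blast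
  qed
  have "smooth_family k (\<lambda>t. iter_deriv vs (u t))"
    if "set vs \<subseteq> Basis" "length vs + k \<le> n" for vs k
    using that
  proof (induction k arbitrary: vs)
    case 0
    then show ?case using cont[of vs] by simp
  next
    case (Suc k)
    show ?case
    proof (rule smooth_family_SucI[where u' = "\<lambda>i t. iter_deriv (i # vs) (u t)"])
      show "continuous_on UNIV (\<lambda>(t, x). iter_deriv vs (u t) x)"
        using Suc.prems by (intro cont) auto
      show "smooth_family k (\<lambda>t. iter_deriv (i # vs) (u t))" if "i \<in> Basis" for i
        using Suc.prems that by (intro Suc.IH) auto
      fix t x
      have "iter_deriv vs (u t) differentiable (at x)"
        using u Suc.prems unfolding C0_C_k_def C_k_def by auto
      then have D: "(iter_deriv vs (u t) has_derivative frechet_derivative (iter_deriv vs (u t)) (at x)) (at x)"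
        by (simp add: frechet_derivative_works)
      interpret bounded_linear "frechet_derivative (iter_deriv vs (u t)) (at x)"
        using D by (rule has_derivative_bounded_linear)
      have "frechet_derivative (iter_deriv vs (u t)) (at x) =
          (\<lambda>h. \<Sum>i\<in>Basis. (h \<bullet> i) *\<^sub>R iter_deriv (i # vs) (u t) x)"
        by (rule ext) (simp add: sum[symmetric] scaleR[symmetric] euclidean_representation)
      with D show "(iter_deriv vs (u t) has_derivative
          (\<lambda>h. \<Sum>i\<in>Basis. (h \<bullet> i) *\<^sub>R iter_deriv (i # vs) (u t) x)) (at x)"
        by (simp only:)
    qed
  qed
  from this[of "[]" n] show ?thesis by simp
qed

lemma frechet_derivative_partial:
  assumes "has_partials u u'" "i \<in> Basis"
  shows "frechet_derivative (u t) (at x) i = u' i t x"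
proof -
  have "frechet_derivative (u t) (at x) i = (\<Sum>j\<in>Basis. (i \<bullet> j) *\<^sub>R u' j t x)"
    using frechet_derivative_at[OF has_partialsD[OF assms(1)], of t x] by metis
  also have "\<dots> = (\<Sum>j\<in>Basis. if j = i then u' j t x else 0)"
    using assms(2) by (intro sum.cong) (auto simp: inner_Basis)
  also have "\<dots> = u' i t x" using assms(2) by simp
  finally show ?thesis .
qed

lemma smooth_family_iter_deriv:
  assumes "smooth_family n u"
  shows "set vs \<subseteq> Basis \<Longrightarrow> length vs + k \<le> n \<Longrightarrow> smooth_family k (\<lambda>t. iter_deriv vs (u t))"
proof (induction vs arbitrary: k)
  case Nil
  then show ?case using smooth_family_mono[OF assms, of k] by simp
next
  case (Cons i vs)
  from Cons.prems have "smooth_family (Suc k) (\<lambda>t. iter_deriv vs (u t))" by (intro Cons.IH) auto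
  then obtain w' where w': "has_partials (\<lambda>t. iter_deriv vs (u t)) w'"
    "\<And>i. i \<in> Basis \<Longrightarrow> smooth_family k (w' i)"
    using smooth_family_Suc_partials by blast
  have "(\<lambda>t. iter_deriv (i # vs) (u t)) = w' i"
    using frechet_derivative_partial[OF w'(1)] Cons.prems by (simp add: fun_eq_iff)
  then show ?case using w'(2) Cons.prems by (simp del: iter_deriv.simps)
qed

lemma evolving_family_mono: "evolving_family n u v \<Longrightarrow> k \<le> n \<Longrightarrow> evolving_family k u v"
proof (induction k arbitrary: n u v)
  case 0
  then show ?case using evolving_family_time_derivative by auto
next
  case (Suc k)
  then obtain l where l: "n = Suc l" "k \<le> l" by (cases n) auto
  with Suc.prems obtain u' v' where "time_derivative u v" "has_partials u u'" "has_partials v v'"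
    "\<forall>i\<in>Basis. evolving_family l (u' i) (v' i)" by auto
  moreover from this(4) have "\<forall>i\<in>Basis. evolving_family k (u' i) (v' i)"
    using Suc.IH l(2) by blast
  ultimately show ?case by auto
qed

lemma evolving_family_iter_deriv:
  assumes "evolving_family n u v"
  shows "set vs \<subseteq> Basis \<Longrightarrow> length vs + k \<le> n \<Longrightarrow>
    evolving_family k (\<lambda>t. iter_deriv vs (u t)) (\<lambda>t. iter_deriv vs (v t))"
proof (induction vs arbitrary: k)
  case Nil
  then show ?case using evolving_family_mono[OF assms, of k] by simp
next
  case (Cons i vs)
  from Cons.prems have "evolving_family (Suc k) (\<lambda>t. iter_deriv vs (u t)) (\<lambda>t. iter_deriv vs (v t))"
    by (intro Cons.IH) auto
  then obtain w' z' where w': "has_partials (\<lambda>t. iter_deriv vs (u t)) w'"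
    "has_partials (\<lambda>t. iter_deriv vs (v t)) z'"
    "\<And>i. i \<in> Basis \<Longrightarrow> evolving_family k (w' i) (z' i)"
    by auto
  have "(\<lambda>t. iter_deriv (i # vs) (u t)) = w' i" "(\<lambda>t. iter_deriv (i # vs) (v t)) = z' i"
    using frechet_derivative_partial[OF w'(1)] frechet_derivative_partial[OF w'(2)] Cons.prems
    by (simp_all add: fun_eq_iff)
  then show ?case using w'(3) Cons.prems by (simp del: iter_deriv.simps)
qed

lemma smooth_family_imp_C_k:
  assumes "smooth_family n u"
  shows "C_k n (u t)"
  unfolding C_k_def
proof (intro allI impI conjI)
  fix vs :: "'a list" assume vs: "set vs \<subseteq> Basis"
  show "iter_deriv vs (u t) differentiable (at x)" if "length vs < n" for x
  proof -
    have "length vs + Suc 0 \<le> n" using that by simp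
    from smooth_family_Suc_partials[OF smooth_family_iter_deriv[OF assms vs this]]
    obtain w' where "has_partials (\<lambda>t. iter_deriv vs (u t)) w'" by blast
    then show ?thesis using has_partialsD differentiableI by blast
  qed
  show "continuous_on UNIV (iter_deriv vs (u t))" if "length vs \<le> n"
  proof -
    have "continuous_on UNIV (\<lambda>x :: 'a. (t, x))"
      by (intro continuous_on_Pair continuous_on_const continuous_on_id)
    from continuous_on_compose2[OF
        smooth_family_continuous[OF smooth_family_iter_deriv[OF assms vs, of 0]] this subset_UNIV]
    show ?thesis using that by simp
  qed
qed

lemma smooth_family_imp_C0_C_k:
  assumes "smooth_family n u"
  shows "C0_C_k n u"
  unfolding C0_C_k_def C_k_tendsto_def
  using smooth_family_imp_C_k[OF assms]
    continuous_family_uniform_limit[OF smooth_family_continuous[OF smooth_family_iter_deriv[OF assms]]]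
  by (metis Nat.add_0_right)

lemma iter_deriv_difference_quotient:
  assumes f: "C_k n f" and g: "C_k n g"
  shows "set vs \<subseteq> Basis \<Longrightarrow> length vs \<le> n \<Longrightarrow>
    iter_deriv vs (\<lambda>x. (f x - g x) /\<^sub>R h) = (\<lambda>x. (iter_deriv vs f x - iter_deriv vs g x) /\<^sub>R h)"
proof (induction vs)
  case (Cons i vs)
  show ?case
  proof (rule ext)
    fix x
    have "iter_deriv vs f differentiable (at x)" "iter_deriv vs g differentiable (at x)"
      using f g Cons.prems unfolding C_k_def by auto
    then have "((\<lambda>x. (iter_deriv vs f x - iter_deriv vs g x) /\<^sub>R h) has_derivative
        (\<lambda>v. (frechet_derivative (iter_deriv vs f) (at x) v -
           frechet_derivative (iter_deriv vs g) (at x) v) /\<^sub>R h)) (at x)"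
      unfolding frechet_derivative_works by (intro has_derivative_scaleR_right has_derivative_diff)
    note fun_cong[OF frechet_derivative_at[OF this], of i]
    moreover have "iter_deriv vs (\<lambda>x. (f x - g x) /\<^sub>R h) =
        (\<lambda>x. (iter_deriv vs f x - iter_deriv vs g x) /\<^sub>R h)"
      using Cons by simp
    ultimately show "iter_deriv (i # vs) (\<lambda>x. (f x - g x) /\<^sub>R h) x =
        (iter_deriv (i # vs) f x - iter_deriv (i # vs) g x) /\<^sub>R h"
      by simp
  qed
qed simp

text \<open>By the mean value inequality the difference quotient deviates from \<open>w' t\<close> at most by the oscillation
of \<open>w'\<close> between the times \<open>t\<close> and \<open>t + h\<close>, which is small uniformly on \<open>S\<close>.\<close>

lemma time_derivative_uniform_limit:
  fixes w :: "real \<Rightarrow> 'a::euclidean_space \<Rightarrow> 'b::real_normed_vector"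
  assumes w: "time_derivative w w'" and "compact S"
  shows "uniform_limit S (\<lambda>h x. (w (t + h) x - w t x) /\<^sub>R h) (w' t) (at 0)"
proof (rule uniform_limitI)
  fix e :: real assume "0 < e"
  have w'_cont: "continuous_on UNIV (\<lambda>(t, x). w' t x)"
    and w': "\<And>s x. ((\<lambda>s. w s x) has_vector_derivative w' s x) (at s)"
    using w by (auto simp: time_derivative_def)
  from continuous_family_uniform_limit[OF w'_cont \<open>compact S\<close>, of t]
  have "\<forall>\<^sub>F s in at t. \<forall>x\<in>S. dist (w' s x) (w' t x) < e / 2"
    using \<open>0 < e\<close> by (intro uniform_limitD) auto
  then obtain d where "0 < d"
    and d: "\<And>s x. s \<noteq> t \<Longrightarrow> dist s t < d \<Longrightarrow> x \<in> S \<Longrightarrow> dist (w' s x) (w' t x) < e / 2"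
    unfolding eventually_at by blast
  have "dist ((w (t + h) x - w t x) /\<^sub>R h) (w' t x) < e" if h: "h \<noteq> 0" "\<bar>h\<bar> < d" and "x \<in> S" for h x
  proof -
    have "norm (w (t + h) x - w t x - (t + h - t) *\<^sub>R w' t x) \<le> norm (t + h - t) * (e / 2)"
    proof (rule vector_differentiable_bound_linearization[where S = "ball t d"])
      show "((\<lambda>s. w s x) has_vector_derivative w' s x) (at s within ball t d)" for s
        by (rule has_vector_derivative_at_within[OF w'])
      show "closed_segment t (t + h) \<subseteq> ball t d"
        using h \<open>0 < d\<close> by (intro closed_segment_subset) (auto simp: dist_norm)
      show "norm (w' s x - w' t x) \<le> e / 2" if "s \<in> ball t d" for s
        using d[of s x] that \<open>x \<in> S\<close> \<open>0 < e\<close>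
        by (cases "s = t") (auto simp: dist_norm dist_commute less_imp_le)
    qed (use \<open>0 < d\<close> in auto)
    then have *: "norm (w (t + h) x - w t x - h *\<^sub>R w' t x) \<le> \<bar>h\<bar> * (e / 2)" by simp
    have "(w (t + h) x - w t x) /\<^sub>R h - w' t x = (w (t + h) x - w t x - h *\<^sub>R w' t x) /\<^sub>R h"
      using h by (simp add: scaleR_diff_right)
    then have "norm ((w (t + h) x - w t x) /\<^sub>R h - w' t x) = norm (w (t + h) x - w t x - h *\<^sub>R w' t x) / \<bar>h\<bar>"
      by (simp add: divide_inverse mult.commute)
    also have "\<dots> \<le> e / 2" using * h by (simp add: field_simps)
    finally show ?thesis using \<open>0 < e\<close> by (simp add: dist_norm)
  qed
  then show "\<forall>\<^sub>F h in at 0. \<forall>x\<in>S. dist ((w (t + h) x - w t x) /\<^sub>R h) (w' t x) < e"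
    unfolding eventually_at using \<open>0 < d\<close> by (auto simp: dist_norm)
qed

theorem evolving_family_imp_C1_C_k:
  assumes uv: "evolving_family n u v"
  shows "C1_C_k n u"
  unfolding C1_C_k_def
proof (intro conjI exI[of _ v] allI)
  have smooth: "smooth_family n u" "smooth_family n v"
    using evolving_family_imp_smooth[OF uv] by auto
  show C_k_u: "C_k n (u t)" for t using smooth(1) by (rule smooth_family_imp_C_k)
  show "C0_C_k n v" using smooth(2) by (rule smooth_family_imp_C0_C_k)
  show "C_k_tendsto n (\<lambda>h x. (u (t + h) x - u t x) /\<^sub>R h) (v t) (at 0)" for t
    unfolding C_k_tendsto_def
  proof (intro allI impI, elim conjE)
    fix vs :: "'a list" and S :: "'a set"
    assume vs: "set vs \<subseteq> Basis" "length vs \<le> n" and "compact S"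
    have "time_derivative (\<lambda>t. iter_deriv vs (u t)) (\<lambda>t. iter_deriv vs (v t))"
      using evolving_family_iter_deriv[OF uv vs(1), of 0] vs(2) by simp
    from time_derivative_uniform_limit[OF this \<open>compact S\<close>, of t]
    show "uniform_limit S (\<lambda>h. iter_deriv vs (\<lambda>x. (u (t + h) x - u t x) /\<^sub>R h))
        (iter_deriv vs (v t)) (at 0)"
      by (simp only: iter_deriv_difference_quotient[OF C_k_u C_k_u vs])
  qed
qed

section \<open>The transport equation on the torus\<close>

lemma torus_proj_rep [simp]: "torus_proj (torus_rep q) = q"
  by (rule Quotient_abs_rep[OF Quotient_torus])

text \<open>A lift witnessing the differentiability at one time may be discontinuous at other times, so the
local lifts cannot be glued. The second component of \<open>Z\<close> is however a well-defined differentiable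
curve in the plane, equal to the velocity of the first; its antiderivative \<open>X\<close> is the only candidate
for a lift of the position. To see that \<open>X\<close> is a lift, the difference \<open>\<theta>\<close> of each coordinate to an
arbitrary representative is mapped to the unit circle: \<open>cis (2 pi \<theta>)\<close> does not depend on the
representative, has derivative zero, and equals 1 at time 0.\<close>

lemma torus_phase_lift:
  assumes Z: "\<And>t. has_phase_derivative Z (d t) t"
    and velocity: "\<And>t. fst (d t) = snd (Z t)"
    and z: "phase_proj z = Z 0"
  obtains \<zeta> where "\<zeta> 0 = z" "\<forall>t. phase_proj (\<zeta> t) = Z t"
    "\<forall>t. (\<zeta> has_vector_derivative d t) (at t)"
proof -
  have lift: "\<exists>\<zeta>. (\<forall>\<^sub>F s in nhds t. phase_proj (\<zeta> s) = Z s) \<and> (\<zeta> has_vector_derivative d t) (at t)" for t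
    using Z[of t] by (simp add: has_phase_derivative_def)
  define y where "y t = snd (Z t)" for t
  have y': "(y has_vector_derivative snd (d t)) (at t)" for t
  proof -
    obtain \<zeta> where \<zeta>: "\<forall>\<^sub>F s in nhds t. phase_proj (\<zeta> s) = Z s" "(\<zeta> has_vector_derivative d t) (at t)"
      using lift[of t] by blast
    have "((\<lambda>s. snd (\<zeta> s)) has_vector_derivative snd (d t)) (at t)"
      by (rule bounded_linear.has_vector_derivative[OF bounded_linear_snd \<zeta>(2)])
    moreover have ev: "\<forall>\<^sub>F s in nhds t. snd (\<zeta> s) = y s"
      using \<zeta>(1) by (rule eventually_mono) (metis phase_proj_def snd_conv y_def)
    ultimately show ?thesis
      using has_vector_derivative_cong_ev[where x = t and S = UNIV and f = "\<lambda>s. snd (\<zeta> s)" and g = y]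
        eventually_nhds_x_imp_x[OF ev] by simp
  qed
  then have "continuous_on UNIV y"
    by (meson continuous_at_imp_continuous_on has_vector_derivative_continuous)
  then obtain X where X: "X 0 = fst z" "\<forall>t. (X has_vector_derivative y t) (at t)"
    using continuous_antiderivative[of y "fst z"] by metis
  have "same_torus_point (torus_rep (fst (Z t))) (X t)" for t
    unfolding same_torus_point_def
  proof
    fix j
    define \<theta> where "\<theta> s = torus_rep (fst (Z s)) $ j - X s $ j" for s
    have "((\<lambda>s. cis (2 * pi * \<theta> s)) has_vector_derivative 0) (at t)" for t
    proof -
      obtain \<zeta> where \<zeta>: "\<forall>\<^sub>F s in nhds t. phase_proj (\<zeta> s) = Z s" "(\<zeta> has_vector_derivative d t) (at t)"
        using lift[of t] by blast
      have "((\<lambda>s. fst (\<zeta> s) $ j - X s $ j) has_vector_derivative fst (d t) $ j - y t $ j) (at t)"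
        by (intro has_vector_derivative_diff
            bounded_linear.has_vector_derivative[OF bounded_linear_vec_nth]
            bounded_linear.has_vector_derivative[OF bounded_linear_fst] \<zeta>(2) X(2)[rule_format])
      then have "((\<lambda>s. fst (\<zeta> s) $ j - X s $ j) has_derivative (\<lambda>h. 0)) (at t)"
        by (simp add: velocity y_def has_vector_derivative_def)
      then have "((\<lambda>s. cis (2 * pi * (fst (\<zeta> s) $ j - X s $ j))) has_vector_derivative 0) (at t)"
        using has_derivative_cis[OF has_derivative_mult_right[of _ "\<lambda>h. 0" "at t" "2 * pi"]]
        by (force simp: has_vector_derivative_def)
      moreover have ev: "\<forall>\<^sub>F s in nhds t. cis (2 * pi * (fst (\<zeta> s) $ j - X s $ j)) = cis (2 * pi * \<theta> s)"
        using \<zeta>(1)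
      proof (rule eventually_mono)
        fix s assume "phase_proj (\<zeta> s) = Z s"
        then have "torus_proj (fst (\<zeta> s)) = torus_proj (torus_rep (fst (Z s)))"
          by (metis fst_conv phase_proj_def torus_proj_rep)
        then have "fst (\<zeta> s) $ j - torus_rep (fst (Z s)) $ j \<in> \<int>"
          unfolding torus.abs_eq_iff same_torus_point_def by blast
        then have "cis (2 * pi * (fst (\<zeta> s) $ j - torus_rep (fst (Z s)) $ j)) = 1"
          by (rule cis_multiple_2pi)
        moreover have "2 * pi * (fst (\<zeta> s) $ j - X s $ j) =
            2 * pi * (fst (\<zeta> s) $ j - torus_rep (fst (Z s)) $ j) + 2 * pi * \<theta> s"
          by (simp add: \<theta>_def algebra_simps)
        ultimately show "cis (2 * pi * (fst (\<zeta> s) $ j - X s $ j)) = cis (2 * pi * \<theta> s)"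
          by (simp only: cis_mult[symmetric] mult_1)
      qed
      ultimately show ?thesis
        using has_vector_derivative_cong_ev[where x = t and S = UNIV and f = "\<lambda>s. cis (2 * pi * (fst (\<zeta> s) $ j - X s $ j))"
            and g = "\<lambda>s. cis (2 * pi * \<theta> s)"] eventually_nhds_x_imp_x[OF ev] by simp
    qed
    then obtain c where c: "\<And>s. cis (2 * pi * \<theta> s) = c"
      using has_vector_derivative_zero_constant[of UNIV "\<lambda>s. cis (2 * pi * \<theta> s)"] by auto
    have "torus_proj (torus_rep (fst (Z 0))) = torus_proj (X 0)"
      using z by (metis X(1) fst_conv phase_proj_def torus_proj_rep)
    then have "\<theta> 0 \<in> \<int>"
      unfolding torus.abs_eq_iff same_torus_point_def \<theta>_def by blast
    then have "cis (2 * pi * \<theta> 0) = 1" by (rule cis_multiple_2pi)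
    then have "cis (2 * pi * \<theta> t) = 1" using c by metis
    then obtain n :: int where "2 * pi * \<theta> t = of_int (2 * n) * pi"
      by (auto simp: cis_conv_exp exp_eq_1)
    then have "\<theta> t = of_int n" by simp
    then show "torus_rep (fst (Z t)) $ j - X t $ j \<in> \<int>" by (simp add: \<theta>_def)
  qed
  then have "torus_proj (X t) = fst (Z t)" for t
    by (metis torus.abs_eq_iff torus_proj_rep)
  then have "phase_proj (X t, y t) = Z t" for t
    by (simp add: phase_proj_def y_def)
  moreover have "((\<lambda>t. (X t, y t)) has_vector_derivative d t) (at t)" for t
    using has_vector_derivative_Pair[OF X(2)[rule_format] y', of t] velocity[of t]
    by (metis prod.collapse y_def)
  moreover have "(X 0, y 0) = z"
    using z X(1) by (metis phase_proj_def prod.collapse snd_conv y_def)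
  ultimately show ?thesis by (intro that[of "\<lambda>t. (X t, y t)"]) auto
qed

definition torus_periodic :: "(real \<Rightarrow> real^2 \<Rightarrow> 'b) \<Rightarrow> bool" where
  "torus_periodic g \<longleftrightarrow> (\<forall>t x y. same_torus_point x y \<longrightarrow> g t x = g t y)"

lemma torus_periodic_partial:
  fixes g :: "real \<Rightarrow> real^2 \<Rightarrow> 'b::real_normed_vector"
  assumes g: "torus_periodic g" and g': "has_partials g g'" and i: "i \<in> Basis"
  shows "torus_periodic (g' i)"
  unfolding torus_periodic_def
proof (intro allI impI)
  fix t and x y :: "real^2" assume xy: "same_torus_point x y"
  have "((\<lambda>a. a + (y - x)) has_derivative (\<lambda>h. h)) (at x)"
    by (auto intro!: derivative_eq_intros)
  from has_derivative_compose[OF this has_partialsD[OF g']]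
  have "((\<lambda>a. g t (a + (y - x))) has_derivative (\<lambda>h. \<Sum>i\<in>Basis. (h \<bullet> i) *\<^sub>R g' i t y)) (at x)"
    by simp
  moreover have "g t (a + (y - x)) = g t a" for a
  proof -
    have "same_torus_point (a + (y - x)) a"
      using xy unfolding same_torus_point_def by (metis Ints_minus add_diff_cancel_left' minus_diff_eq vector_minus_component)
    then show ?thesis using g by (simp add: torus_periodic_def)
  qed
  ultimately have "(g t has_derivative (\<lambda>h. \<Sum>i\<in>Basis. (h \<bullet> i) *\<^sub>R g' i t y)) (at x)" by simp
  from frechet_derivative_at[OF this] frechet_derivative_at[OF has_partialsD[OF g'], of t x]
  have eq: "(\<lambda>h. \<Sum>i\<in>Basis. (h \<bullet> i) *\<^sub>R g' i t y) = (\<lambda>h. \<Sum>i\<in>Basis. (h \<bullet> i) *\<^sub>R g' i t x)"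
    by simp
  have "(\<Sum>j\<in>Basis. (i \<bullet> j) *\<^sub>R D j) = D i" for D :: "real^2 \<Rightarrow> 'b"
  proof -
    have "(\<Sum>j\<in>Basis. (i \<bullet> j) *\<^sub>R D j) = (\<Sum>j\<in>Basis. if j = i then D j else 0)"
      using i by (intro sum.cong) (auto simp: inner_Basis)
    then show ?thesis using i by simp
  qed
  then show "g' i t x = g' i t y" using fun_cong[OF eq, of i] by simp
qed

text \<open>Every orbit of the translations meets the compact fundamental domain \<open>cbox 0 1\<close>.\<close>

lemma torus_periodic_bounded:
  fixes g :: "real \<Rightarrow> real^2 \<Rightarrow> 'b::real_normed_vector"
  assumes g: "torus_periodic g" and cont: "continuous_on UNIV (\<lambda>(t, x). g t x)"
  shows "\<exists>B. \<forall>t x. \<bar>t\<bar> \<le> T \<longrightarrow> norm (g t x) \<le> B"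
proof -
  have "bounded ((\<lambda>(t, x). g t x) ` ({-T..T} \<times> cbox 0 1))"
    by (intro compact_imp_bounded compact_continuous_image compact_Times compact_Icc compact_cbox
        continuous_on_subset[OF cont] subset_UNIV)
  then obtain B where B: "\<forall>y\<in>(\<lambda>(t, x). g t x) ` ({-T..T} \<times> cbox 0 1). norm y \<le> B"
    unfolding bounded_iff by blast
  have "norm (g t x) \<le> B" if "\<bar>t\<bar> \<le> T" for t x
  proof -
    define x' :: "real^2" where "x' = (\<chi> i. frac (x $ i))"
    have "x' \<in> cbox 0 1"
      by (auto simp: x'_def mem_box_cart less_imp_le[OF frac_lt_1])
    then have "norm (g t x') \<le> B"
      using B that by (force simp: abs_le_iff)
    moreover have "same_torus_point x x'"
      by (simp add: same_torus_point_def x'_def frac_def)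
    ultimately show ?thesis using g by (simp add: torus_periodic_def)
  qed
  then show ?thesis by blast
qed

lemma torus_periodic_lipschitz:
  fixes g :: "real \<Rightarrow> real^2 \<Rightarrow> 'b::real_normed_vector"
  assumes g: "torus_periodic g" and smooth: "smooth_family (Suc n) g"
  shows "\<exists>L. \<forall>t x y. \<bar>t\<bar> \<le> T \<longrightarrow> norm (g t x - g t y) \<le> L * norm (x - y)"
proof -
  obtain g' where g': "has_partials g g'" "\<And>i. i \<in> Basis \<Longrightarrow> smooth_family n (g' i)"
    using smooth_family_Suc_partials[OF smooth] by blast
  have "\<exists>B. \<forall>t x. \<bar>t\<bar> \<le> T \<longrightarrow> norm (g' i t x) \<le> B" if "i \<in> Basis" for i
    by (rule torus_periodic_bounded[OF torus_periodic_partial[OF g g'(1) that]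
          smooth_family_continuous[OF g'(2)[OF that]]])
  then have "\<forall>i\<in>Basis. \<exists>B. \<forall>t x. \<bar>t\<bar> \<le> T \<longrightarrow> norm (g' i t x) \<le> B" ..
  then obtain B where B: "\<forall>i\<in>Basis. \<forall>t x. \<bar>t\<bar> \<le> T \<longrightarrow> norm (g' i t x) \<le> B i"
    by (rule bchoice[THEN exE])
  have "norm (g t x - g t y) \<le> (\<Sum>i\<in>Basis. B i) * norm (x - y)" if t: "\<bar>t\<bar> \<le> T" for t x y
  proof (rule differentiable_bound[OF convex_UNIV _ _ UNIV_I UNIV_I])
    show "(g t has_derivative (\<lambda>h. \<Sum>i\<in>Basis. (h \<bullet> i) *\<^sub>R g' i t x)) (at x within UNIV)" for x
      using has_partialsD[OF g'(1)] by simp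
    show "onorm (\<lambda>h. \<Sum>i\<in>Basis. (h \<bullet> i) *\<^sub>R g' i t x) \<le> (\<Sum>i\<in>Basis. B i)" for x
    proof (rule onorm_le)
      fix h :: "real^2"
      have "norm (\<Sum>i\<in>Basis. (h \<bullet> i) *\<^sub>R g' i t x) \<le> (\<Sum>i\<in>Basis. norm h * B i)"
        using B t by (intro sum_norm_le) (auto intro!: mult_mono Basis_le_norm)
      then show "norm (\<Sum>i\<in>Basis. (h \<bullet> i) *\<^sub>R g' i t x) \<le> (\<Sum>i\<in>Basis. B i) * norm h"
        by (simp add: sum_distrib_left mult.commute)
    qed
  qed
  then show ?thesis by blast
qed

lemma transport_field_phase_proj:
  assumes \<psi>: "has_partials (\<lambda>t x. \<psi> t (torus_proj x)) D"
  shows "transport_field \<tau> \<psi> t (phase_proj z) =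
    (snd z, (1 / \<tau>) *\<^sub>R ((D (axis 2 1) t (fst z) *\<^sub>R axis 1 1 - D (axis 1 1) t (fst z) *\<^sub>R axis 2 1) - snd z))"
proof -
  have periodic: "torus_periodic (\<lambda>t x. \<psi> t (torus_proj x))"
    by (simp add: torus_periodic_def torus.abs_eq_iff[symmetric])
  have "torus_partial i (\<psi> t) (torus_proj x) = D (axis i 1) t x" for i x
  proof -
    have b: "axis i (1 :: real) \<in> Basis" by (simp add: axis_in_Basis_iff)
    have "torus_partial i (\<psi> t) (torus_proj x) = D (axis i 1) t (torus_rep (torus_proj x))"
      unfolding torus_partial_def by (rule frechet_derivative_partial[OF \<psi> b])
    also have "\<dots> = D (axis i 1) t x"
      using torus_periodic_partial[OF periodic \<psi> b] torus.abs_eq_iff[of "torus_rep (torus_proj x)" x]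
      unfolding torus_periodic_def torus_proj_rep by blast
    finally show ?thesis .
  qed
  then have "grad_perp (\<psi> t) (torus_proj (fst z)) =
      D (axis 2 1) t (fst z) *\<^sub>R axis 1 1 - D (axis 1 1) t (fst z) *\<^sub>R axis 2 1"
    by (simp add: grad_perp_def vec_eq_iff forall_2 axis_def)
  then show ?thesis by (simp add: transport_field_def phase_proj_def)
qed

text \<open>One of the \<open>n + 2\<close> derivatives of \<open>\<psi>\<close> is consumed by the velocity \<open>grad_perp\<close>. The remaining \<open>n + 1\<close>
are the regularity of the flow, and at least one of them is there to give the Lipschitz bound on the
covering.\<close>

theorem transport_unique_global_solution:
  fixes \<psi> :: "real \<Rightarrow> torus \<Rightarrow> real"
  assumes \<psi>: "C0_C_k_torus (Suc (Suc n)) \<psi>"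
  shows "unique_global_C_k_solution (Suc n) (transport_field \<tau> \<psi>)"
proof -
  have "smooth_family (Suc (Suc n)) (\<lambda>t x. \<psi> t (torus_proj x))"
    using \<psi> unfolding C0_C_k_torus_def by (rule C0_C_k_imp_smooth_family)
  then obtain D where D: "has_partials (\<lambda>t x. \<psi> t (torus_proj x)) D"
    "\<And>i. i \<in> Basis \<Longrightarrow> smooth_family (Suc n) (D i)"
    using smooth_family_Suc_partials by blast
  have periodic: "torus_periodic (\<lambda>t x. \<psi> t (torus_proj x))"
    by (simp add: torus_periodic_def torus.abs_eq_iff[symmetric])
  have basis: "axis i (1 :: real) \<in> Basis" for i :: 2 by (simp add: axis_in_Basis_iff)
  \<comment> \<open>The field on the universal covering.\<close>
  define f where "f t z = transport_field \<tau> \<psi> t (phase_proj z)" for t z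
  have f_eq: "f t z = (snd z, (1 / \<tau>) *\<^sub>R ((D (axis 2 1) t (fst z) *\<^sub>R axis 1 1 +
      - (D (axis 1 1) t (fst z) *\<^sub>R axis 2 1)) + - snd z))" for t z
    by (simp add: f_def transport_field_phase_proj[OF D(1)])
  have f_smooth: "smooth_family (Suc n) f"
  proof -
    have D_fst: "smooth_family (Suc n) (\<lambda>t z. D (axis i 1) t (fst z) *\<^sub>R (axis j 1 :: plane))"
      for i j :: 2
      by (rule smooth_family_scaleR[OF smooth_family_compose[OF D(2)[OF basis]
              smooth_family_linear[OF bounded_linear_fst]] smooth_family_const])
    have neg: "smooth_family (Suc n) (\<lambda>t z. - u t z)" if "smooth_family (Suc n) u"
      for u :: "real \<Rightarrow> plane \<times> plane \<Rightarrow> plane"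
      by (rule smooth_family_bounded_linear[OF bounded_linear_minus[OF bounded_linear_ident] that])
    have "smooth_family (Suc n) (\<lambda>t z. (snd z, (1 / \<tau>) *\<^sub>R ((D (axis 2 1) t (fst z) *\<^sub>R (axis 1 1 :: plane) +
      - (D (axis 1 1) t (fst z) *\<^sub>R axis 2 1)) + - snd z)))"
      by (rule smooth_family_Pair[OF smooth_family_linear[OF bounded_linear_snd]
            smooth_family_scaleR[OF smooth_family_const
              smooth_family_add[OF smooth_family_add[OF D_fst neg[OF D_fst]]
                neg[OF smooth_family_linear[OF bounded_linear_snd]]]]])
    then show ?thesis by (simp only: f_eq[abs_def])
  qed
  have f_lip: "\<exists>L. \<forall>t z z'. \<bar>t\<bar> \<le> T \<longrightarrow> norm (f t z - f t z') \<le> L * norm (z - z')" for T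
  proof -
    have "\<forall>i. \<exists>L. \<forall>t x y. \<bar>t\<bar> \<le> T \<longrightarrow>
        norm (D (axis i 1) t x - D (axis i 1) t y) \<le> L * norm (x - y)"
      using torus_periodic_lipschitz[OF torus_periodic_partial[OF periodic D(1) basis] D(2)[OF basis]] ..
    from choice[OF this] obtain L where L: "\<forall>i t x y. \<bar>t\<bar> \<le> T \<longrightarrow>
        norm (D (axis i 1) t x - D (axis i 1) t y) \<le> L i * norm (x - y)" by blast
    have "norm (f t z - f t z') \<le> (1 + \<bar>1 / \<tau>\<bar> * (\<bar>L 2\<bar> + \<bar>L 1\<bar> + 1)) * norm (z - z')"
      if t: "\<bar>t\<bar> \<le> T" for t z z'
    proof -
      have fst_le: "norm (fst z - fst z') \<le> norm (z - z')" and snd_le: "norm (snd z - snd z') \<le> norm (z - z')"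
        using dist_fst_le[of z z'] dist_snd_le[of z z'] by (simp_all add: dist_norm)
      define \<Delta> where "\<Delta> i = D (axis i 1) t (fst z) - D (axis i 1) t (fst z')" for i :: 2
      have \<Delta>: "norm (\<Delta> i) \<le> \<bar>L i\<bar> * norm (z - z')" for i
      proof -
        have "norm (\<Delta> i) \<le> L i * norm (fst z - fst z')" unfolding \<Delta>_def by (rule L[rule_format, OF t])
        also have "\<dots> \<le> \<bar>L i\<bar> * norm (z - z')" using fst_le by (intro mult_mono) auto
        finally show ?thesis .
      qed
      define v where "v = \<Delta> 2 *\<^sub>R axis 1 1 - \<Delta> 1 *\<^sub>R axis 2 1 - (snd z - snd z')"
      have "norm v \<le> norm (\<Delta> 2) + norm (\<Delta> 1) + norm (snd z - snd z')"
        unfolding v_def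
        using norm_triangle_ineq4[of "\<Delta> 2 *\<^sub>R axis 1 1 - \<Delta> 1 *\<^sub>R axis 2 1" "snd z - snd z'"]
          norm_triangle_ineq4[of "\<Delta> 2 *\<^sub>R axis 1 1 :: plane" "\<Delta> 1 *\<^sub>R axis 2 1"]
        by (simp add: norm_axis_1)
      also have "\<dots> \<le> (\<bar>L 2\<bar> + \<bar>L 1\<bar> + 1) * norm (z - z')"
        using \<Delta>[of 1] \<Delta>[of 2] snd_le by (simp add: algebra_simps)
      finally have "\<bar>1 / \<tau>\<bar> * norm v \<le> \<bar>1 / \<tau>\<bar> * ((\<bar>L 2\<bar> + \<bar>L 1\<bar> + 1) * norm (z - z'))"
        by (rule mult_left_mono) simp
      moreover have "f t z - f t z' = (snd z - snd z', (1 / \<tau>) *\<^sub>R v)"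
        by (simp add: f_eq \<Delta>_def v_def algebra_simps)
      then have "norm (f t z - f t z') \<le> norm (snd z - snd z') + \<bar>1 / \<tau>\<bar> * norm v"
        using norm_Pair_le by (metis norm_scaleR real_norm_def)
      ultimately show ?thesis using snd_le by (simp add: algebra_simps)
    qed
    then show ?thesis by blast
  qed
  have "\<exists>u. u 0 = z \<and> (\<forall>t. (u has_vector_derivative f t (u t)) (at t))" for z
    using global_ode_solution[OF smooth_family_continuous[OF f_smooth] f_lip, of z] by metis
  then obtain u where u: "\<And>z. u z 0 = z" "\<And>z t. (u z has_vector_derivative f t (u z t)) (at t)"
    by metis
  define U where "U t z = u z t" for t z
  have U0: "U 0 = (\<lambda>z. z)" by (simp add: U_def u fun_eq_iff)
  have U': "((\<lambda>s. U s z) has_vector_derivative f t (U t z)) (at t)" for t z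
    unfolding U_def by (rule u)
  have U_unique: "\<zeta> = (\<lambda>t. U t (\<zeta> 0))"
    if \<zeta>': "\<And>t. (\<zeta> has_vector_derivative f t (\<zeta> t)) (at t)" for \<zeta>
  proof
    fix t
    obtain L where L: "\<And>s z z'. \<bar>s\<bar> \<le> \<bar>t\<bar> \<Longrightarrow> norm (f s z - f s z') \<le> L * norm (z - z')"
      using f_lip by metis
    have "norm (\<zeta> t - U t (\<zeta> 0)) \<le> exp ((\<bar>L\<bar> + 1) * \<bar>t\<bar>) * (norm (\<zeta> 0 - U 0 (\<zeta> 0)) + 0)"
    proof (rule gronwall)
      show "((\<lambda>s. \<zeta> s - U s (\<zeta> 0)) has_vector_derivative f s (\<zeta> s) - f s (U s (\<zeta> 0))) (at s)" for s
        by (intro has_vector_derivative_diff \<zeta>' U')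
      show "norm (f s (\<zeta> s) - f s (U s (\<zeta> 0))) \<le> \<bar>L\<bar> * norm (\<zeta> s - U s (\<zeta> 0)) + 0"
        if "\<bar>s\<bar> \<le> \<bar>t\<bar>" for s
        using order_trans[OF L[OF that] mult_right_mono[OF abs_ge_self norm_ge_zero]] by simp
    qed auto
    then show "\<zeta> t = U t (\<zeta> 0)" by (simp add: U0)
  qed
  have solution: "global_solution (transport_field \<tau> \<psi>) (phase_proj z) (\<lambda>t. phase_proj (U t z))" for z
    unfolding global_solution_def has_phase_derivative_def
    using U'[of z] by (auto simp: U0 f_def intro!: exI[of _ "\<lambda>t. U t z"])
  have unique: "Z = (\<lambda>t. phase_proj (U t z))"
    if Z: "global_solution (transport_field \<tau> \<psi>) (phase_proj z) Z" for Z z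
  proof -
    obtain \<zeta> where \<zeta>: "\<zeta> 0 = z" "\<forall>t. phase_proj (\<zeta> t) = Z t"
      "\<forall>t. (\<zeta> has_vector_derivative transport_field \<tau> \<psi> t (Z t)) (at t)"
    proof (rule torus_phase_lift)
      show "has_phase_derivative Z (transport_field \<tau> \<psi> t (Z t)) t" for t
        using Z by (simp add: global_solution_def)
      show "fst (transport_field \<tau> \<psi> t (Z t)) = snd (Z t)" for t
        by (simp add: transport_field_def)
      show "phase_proj z = Z 0" using Z by (simp add: global_solution_def)
    qed auto
    have "\<zeta> = (\<lambda>t. U t (\<zeta> 0))"
      using \<zeta>(2,3) by (intro U_unique) (simp add: f_def)
    then show ?thesis using \<zeta>(1,2) by (metis ext)
  qed
  have flow: "(THE Z. global_solution (transport_field \<tau> \<psi>) (phase_proj z) Z) = (\<lambda>t. phase_proj (U t z))" for z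
    using solution unique by (rule the_equality)
  have "evolving_family (Suc n) U (\<lambda>t z. f t (U t z))"
  proof -
    have "evolving_family (Suc n) U (\<lambda>t z. (\<lambda>t z. f t (snd z)) t (z, U t z))"
    proof (rule solution_evolving_family)
      show "smooth_family (Suc n) (\<lambda>t z :: (plane \<times> plane) \<times> (plane \<times> plane). f t (snd z))"
        by (rule smooth_family_compose[OF f_smooth smooth_family_linear[OF bounded_linear_snd]])
      show "lipschitz_in_state (\<lambda>t z :: (plane \<times> plane) \<times> (plane \<times> plane). f t (snd z))"
        unfolding lipschitz_in_state_def using f_lip by simp
      show "smooth_family (Suc n) (\<lambda>_. U 0)"
        unfolding U0 by (rule smooth_family_linear[OF bounded_linear_ident])
    qed (simp add: U')
    then show ?thesis by simp
  qed
  then have "C1_C_k (Suc n) U" by (rule evolving_family_imp_C1_C_k)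
  then have "C1_C_k_phase (Suc n) (\<lambda>t z. (THE Z. global_solution (transport_field \<tau> \<psi>) z Z) t)"
    unfolding C1_C_k_phase_def by (intro exI[of _ U]) (simp add: flow)
  moreover have "\<exists>!Z. global_solution (transport_field \<tau> \<psi>) z Z" for z
  proof -
    have "phase_proj (torus_rep (fst z), snd z) = z" by (simp add: phase_proj_def)
    then show ?thesis using solution unique by metis
  qed
  ultimately show ?thesis by (simp add: unique_global_C_k_solution_def)
qed

theorem corollary4p7:
  fixes M :: "'w measure"
    and H \<nu> \<tau> c \<gamma> :: real
    and m :: nat
    and \<alpha> \<Lambda> :: "real^2 \<Rightarrow> real"
    and \<beta> :: "real^2 \<Rightarrow> real \<Rightarrow> 'w \<Rightarrow> complex"
    and \<psi> :: "real \<Rightarrow> torus \<Rightarrow> 'w \<Rightarrow> real"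
  assumes "prob_space M"
    and "\<tau> > 0" and "\<nu> > 0" and "0 < H" and "H < 1"
    and "c > 0" and "\<And>k. k \<in> freqs \<Longrightarrow> \<alpha> k \<ge> c"
    and "\<And>k. k \<in> freqs \<Longrightarrow> \<alpha> k = \<alpha> (- k)"
    and "filterlim \<alpha> at_top (inf at_infinity (principal freqs))"
    and "\<And>k. k \<in> freqs \<Longrightarrow> \<Lambda> k \<ge> 0"
    and "\<And>k. k \<in> freqs \<Longrightarrow> sqrt (\<Lambda> k) = sqrt (\<Lambda> (- k))"
    and "bounded ((\<lambda>k. sqrt (\<Lambda> k)) ` freqs)"
    and "fractional_noise M H \<beta>"
    and "m \<ge> 2" and "0 < \<gamma>" and "\<gamma> < 1"
    and "(\<lambda>k. \<Lambda> k * \<alpha> k powr (2 * \<gamma> - 2 * H) * norm k ^ (2 * m)) summable_on freqs"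
    and "(\<lambda>k. \<Lambda> k * \<alpha> k powr (- 2 * H) * norm k powr (2 * real m + 2 * \<gamma>)) summable_on freqs"
    and "version_of_ergodic_mild_solution M H \<nu> \<alpha> \<Lambda> \<beta> \<psi>"
    and "AE \<omega> in M. C0_C_k_torus m (\<lambda>t p. \<psi> t p \<omega>)"
  shows "AE \<omega> in M. unique_global_C_k_solution (m - 1) (transport_field \<tau> (\<lambda>t p. \<psi> t p \<omega>))"
proof -
  \<comment> \<open>The Lipschitz bound for the velocity takes two derivatives of \<open>\<psi>\<close>.\<close>
  obtain n where m: "m = Suc (Suc n)"
    using le_Suc_ex[OF \<open>m \<ge> 2\<close>] by auto
  have "AE \<omega> in M. C0_C_k_torus (Suc (Suc n)) (\<lambda>t p. \<psi> t p \<omega>)"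
    using \<open>AE \<omega> in M. C0_C_k_torus m (\<lambda>t p. \<psi> t p \<omega>)\<close> by (simp only: m)
  then have "AE \<omega> in M. unique_global_C_k_solution (Suc n) (transport_field \<tau> (\<lambda>t p. \<psi> t p \<omega>))"
    by (rule eventually_mono) (rule transport_unique_global_solution)
  then show ?thesis by (simp only: m diff_Suc_1)
qed

end
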